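(* Let $K$ be a field of characteristic zero and let $x+H\in K[x_1,\dots,x_n]^n$ be a polynomial map of degree $d\ge 1$ such that $H(0)=0$. Then: (i) $H$ is of the form $( * )$ if and only if there exists a $T\in\mathrm{GL}_n(K)$ such that the Jacobian of $T^{-1}H(Tx)$ is lower triangular with zeroes on the diagonal, i.e. $H$ is linearly triangularizable and $\mathcal{J}H$ is nilpotent. (ii) $H$ is of the form $( ** )$ if and only if there exist $b_i,c_i\in K^n$, $d_i\in\{1,\dots,d\}$ ($1\le i\le n-1$) and a $T\in\mathrm{GL}_n(K)$ such that $H=\sum_{i=1}^{n-1}(c_i^{\mathrm t}x)^{d_i}b_i$ and the Jacobian of $T^{-1}(c_i^{\mathrm t}Tx)^{d_i}b_i$ is lower triangular with zeroes on the diagonal for all $i\le n-1$. (iii) $H$ is of the form $( *** )$ if and only if there exists a $T\in\mathrm{GL}_n(K)$ such that each component of $T^{-1}H(Tx)$ is a power of a linear form and the Jacobian of $T^{-1}H(Tx)$ is lower triangular with zeroes on the diagonal.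
   Context: $x=(x_1,\dots,x_n)$, vectors are column vectors, $M^{\mathrm t}$ is the transpose, and $\mathcal{J}H=(\partial H_i/\partial x_j)_{i,j}$ is the Jacobian matrix. A linear form is a homogeneous polynomial of degree 1 or the zero polynomial. A polynomial map $G$ over $K$ is linearly triangularizable if there is a $T\in\mathrm{GL}_n(K)$ such that the Jacobian of $T^{-1}G(Tx)$ is a triangular matrix. $H$ is of the form $( * )$ if for some $N\in\mathbb{N}$ there are $b_i,c_i\in K^n$ and $d_i\in\{1,\dots,d\}$ ($1\le i\le N$) with $c_j^{\mathrm t}b_i=0$ for all $1\le j\le i\le N$ and $H=\sum_{i=1}^N(c_i^{\mathrm t}x)^{d_i}b_i$. $H$ is of the form $( ** )$ if this holds with $N=n-1$. $H$ is of the form $( *** )$ if this holds with $N=n-1$ and with $b_1,\dots,b_{n-1}$ linearly independent. *)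

theory Defs
  imports "HOL-Analysis.Analysis" "HOL-Library.Poly_Mapping"
begin

text \<open>
  The polynomial ring K[x_1,...,x_n] is rendered as finitely supported maps from exponent vectors to
  coefficients, with the convolution product of \<^theory>\<open>HOL-Library.Poly_Mapping\<close>. The variables are
  indexed by a finite type \<open>'n\<close>, so n is \<open>CARD('n)\<close>. A linear order on \<open>'n\<close> plays the role of the order
  of the indices 1,...,n; it matters only for triangularity of matrices.
\<close>

type_synonym ('k, 'n) mpoly = "('n \<Rightarrow>\<^sub>0 nat) \<Rightarrow>\<^sub>0 'k"

type_synonym ('k, 'n) polymap = "(('k, 'n) mpoly) ^ 'n"

definition Const :: "'k::zero \<Rightarrow> ('k, 'n) mpoly" where
  "Const a = Poly_Mapping.single 0 a"

definition Var :: "'n \<Rightarrow> ('k::zero_neq_one, 'n) mpoly" where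
  "Var i = Poly_Mapping.single (Poly_Mapping.single i 1) 1"

definition mon_degree :: "('n::finite \<Rightarrow>\<^sub>0 nat) \<Rightarrow> nat" where
  "mon_degree m = (\<Sum>i\<in>UNIV. Poly_Mapping.lookup m i)"

text \<open>The zero polynomial gets degree 0.\<close>

definition total_degree :: "('k::zero, 'n::finite) mpoly \<Rightarrow> nat" where
  "total_degree f = Max (insert 0 (mon_degree ` Poly_Mapping.keys f))"

definition polymap_degree :: "('k::zero, 'n::finite) polymap \<Rightarrow> nat" where
  "polymap_degree F = Max (range (\<lambda>i. total_degree (F $ i)))"

definition homogeneous :: "nat \<Rightarrow> ('k::zero, 'n::finite) mpoly \<Rightarrow> bool" where
  "homogeneous k f \<longleftrightarrow> (\<forall>m\<in>Poly_Mapping.keys f. mon_degree m = k)"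

definition linear_form :: "('k::zero, 'n::finite) mpoly \<Rightarrow> bool" where
  "linear_form f \<longleftrightarrow> f = 0 \<or> homogeneous 1 f"

text \<open>Value of \<open>f\<close> at the point \<open>g\<close>, where \<open>\<phi>\<close> maps the coefficients into the ring containing the
  coordinates of \<open>g\<close>.\<close>

definition mpoly_eval ::
  "('k::zero \<Rightarrow> 'r::comm_semiring_1) \<Rightarrow> 'r ^ 'n \<Rightarrow> ('k, 'n::finite) mpoly \<Rightarrow> 'r" where
  "mpoly_eval \<phi> g f =
     (\<Sum>m\<in>Poly_Mapping.keys f. \<phi> (Poly_Mapping.lookup f m) * (\<Prod>i\<in>UNIV. (g $ i) ^ Poly_Mapping.lookup m i))"

definition polymap_apply :: "('k::comm_semiring_1, 'n::finite) polymap \<Rightarrow> 'k ^ 'n \<Rightarrow> 'k ^ 'n" where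
  "polymap_apply F a = (\<chi> i. mpoly_eval (\<lambda>x. x) a (F $ i))"

definition polymap_comp ::
  "('k::comm_semiring_1, 'n::finite) polymap \<Rightarrow> ('k, 'n) polymap \<Rightarrow> ('k, 'n) polymap" where
  "polymap_comp F G = (\<chi> i. mpoly_eval Const G (F $ i))"

definition id_map :: "('k::comm_semiring_1, 'n::finite) polymap" where
  "id_map = (\<chi> i. Var i)"

definition partial_deriv :: "'n \<Rightarrow> ('k::comm_semiring_1, 'n) mpoly \<Rightarrow> ('k, 'n) mpoly" where
  "partial_deriv j f = (\<Sum>m\<in>Poly_Mapping.keys f.
     Poly_Mapping.single (m - Poly_Mapping.single j 1)
       (of_nat (Poly_Mapping.lookup m j) * Poly_Mapping.lookup f m))"

definition jacobian_matrix :: "('k::comm_semiring_1, 'n::finite) polymap \<Rightarrow> (('k, 'n) mpoly) ^ 'n ^ 'n" where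
  "jacobian_matrix H = (\<chi> i j. partial_deriv j (H $ i))"

definition linear_map :: "'k::comm_semiring_1 ^ 'n::finite ^ 'n::finite \<Rightarrow> ('k, 'n) polymap" where
  "linear_map A = map_matrix Const A *v id_map"

definition conj_map ::
  "'k::comm_semiring_1 ^ 'n::finite ^ 'n::finite \<Rightarrow> ('k, 'n) polymap \<Rightarrow> ('k, 'n) polymap" where
  "conj_map T H = map_matrix Const (matrix_inv T) *v polymap_comp H (linear_map T)"

definition lower_triangular :: "'a::zero ^ 'n::{finite,linorder} ^ 'n::{finite,linorder} \<Rightarrow> bool" where
  "lower_triangular A \<longleftrightarrow> (\<forall>i j. i < j \<longrightarrow> A $ i $ j = 0)"

definition upper_triangular :: "'a::zero ^ 'n::{finite,linorder} ^ 'n::{finite,linorder} \<Rightarrow> bool" where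
  "upper_triangular A \<longleftrightarrow> (\<forall>i j. j < i \<longrightarrow> A $ i $ j = 0)"

definition zero_diagonal :: "'a::zero ^ 'n::finite ^ 'n::finite \<Rightarrow> bool" where
  "zero_diagonal A \<longleftrightarrow> (\<forall>i. A $ i $ i = 0)"

definition nilpotent_matrix :: "'a::semiring_1 ^ 'n::finite ^ 'n::finite \<Rightarrow> bool" where
  "nilpotent_matrix A \<longleftrightarrow> (\<exists>k. (((**) A) ^^ k) (mat 1) = 0)"

definition linearly_triangularizable ::
  "('k::comm_semiring_1, 'n::{finite,linorder}) polymap \<Rightarrow> bool" where
  "linearly_triangularizable G \<longleftrightarrow>
     (\<exists>T. invertible T \<and> (lower_triangular (jacobian_matrix (conj_map T G)) \<or>
                          upper_triangular (jacobian_matrix (conj_map T G))))"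

text \<open>The map \<open>(c\<^sup>t x)\<^sup>e b\<close>.\<close>

definition power_map ::
  "'k::comm_semiring_1 ^ 'n::finite \<Rightarrow> nat \<Rightarrow> 'k ^ 'n \<Rightarrow> ('k, 'n) polymap" where
  "power_map c e b = (\<chi> r. (\<Sum>s\<in>UNIV. Const (c $ s) * Var s) ^ e * Const (b $ r))"

text \<open>Below, \<open>b\<close>, \<open>c\<close>, \<open>e\<close> are sequences of which only the entries 1,...,N matter; \<open>e\<close> holds the
  exponents d_i.\<close>

definition star_representation ::
  "nat \<Rightarrow> nat \<Rightarrow> (nat \<Rightarrow> 'k::comm_semiring_1 ^ 'n::finite) \<Rightarrow> (nat \<Rightarrow> 'k ^ 'n) \<Rightarrow> (nat \<Rightarrow> nat) \<Rightarrow>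
   ('k, 'n) polymap \<Rightarrow> bool" where
  "star_representation d N b c e H \<longleftrightarrow>
     (\<forall>i\<in>{1..N}. e i \<in> {1..d}) \<and>
     (\<forall>i j. 1 \<le> j \<and> j \<le> i \<and> i \<le> N \<longrightarrow> scalar_product (c j) (b i) = 0) \<and>
     H = (\<Sum>i=1..N. power_map (c i) (e i) (b i))"

definition form_star :: "nat \<Rightarrow> ('k::comm_semiring_1, 'n::finite) polymap \<Rightarrow> bool" where
  "form_star d H \<longleftrightarrow> (\<exists>N b c e. star_representation d N b c e H)"

definition form_star2 :: "nat \<Rightarrow> ('k::comm_semiring_1, 'n::finite) polymap \<Rightarrow> bool" where
  "form_star2 d H \<longleftrightarrow> (\<exists>b c e. star_representation d (CARD('n) - 1) b c e H)"

definition form_star3 :: "nat \<Rightarrow> ('k::field, 'n::finite) polymap \<Rightarrow> bool" where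
  "form_star3 d H \<longleftrightarrow>
     (\<exists>b c e. star_representation d (CARD('n) - 1) b c e H \<and>
        inj_on b {1..CARD('n) - 1} \<and> vec.independent (b ` {1..CARD('n) - 1}))"

end

(*
Each term (c^t x)^e b has Jacobian e (c^t x)^(e-1) b c^t, so it is strictly lower triangular exactly
when the first nonzero entry of b comes after the last nonzero entry of c. The orthogonality
c_j^t b_i = 0 (j <= i) says that b_i lies in the i-th member V_i of the decreasing chain
V_i = {v. c_j^t v = 0 for all j <= i}; a basis adapted to this chain makes all terms strictly lower
triangular at once. Conversely, over a field of characteristic zero the r-th component of a map
with strictly lower triangular Jacobian involves only the variables before r, and each of its
monomials is a combination of powers of linear forms in these variables; sorting the resulting
terms by the position of their first nonzero component gives the orthogonality conditions.
When the b_i are independent, b_1, ..., b_(n-1), preceded by a further vector, already is a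
triangularizing basis.
*)

theory Submission
  imports Defs
begin

text \<open>The parts differ in how far the number of terms is controlled. In (i) N is free, so
  components may be split into monomials and these into as many powers as it takes. In (ii) exactly
  n-1 terms are allowed, so the given terms can only be reordered, and a vanishing term is replaced
  by zero vectors instead of being dropped. In (iii) the count n-1 fits because the first component
  of a map with strictly lower triangular Jacobian and no constant term is 0. A conjugation sends a
  term with data c, e, b to one with data T^t c, e, T^-1 b, and this preserves the pairing c^t b.
  Hence representations may be constructed after the change of coordinates and carried back. The
  splitting of monomials is a polarization: x_i (c^t x)^e is 1/(e+1) times the coefficient of t in
  (t x_i + c^t x)^(e+1), and over an infinite field the coefficients of a polynomial in t are
  combinations of its values. The exponents must lie in 1..d. This is where H(0) = 0 and the degree
  bound enter; linear substitutions create no new degrees.\<close>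

section \<open>Polynomial arithmetic\<close>

lemma poly_mapping_eq_sum_single:
  fixes f :: "'a \<Rightarrow>\<^sub>0 'b::comm_monoid_add"
  shows "f = (\<Sum>m\<in>Poly_Mapping.keys f. Poly_Mapping.single m (Poly_Mapping.lookup f m))"
  by (rule poly_mapping_eqI)
    (simp add: lookup_sum lookup_single when_def in_keys_iff)

lemma poly_mapping_single_induct [case_names single add]:
  fixes f :: "'a \<Rightarrow>\<^sub>0 'b::comm_monoid_add"
  assumes single: "\<And>m a. P (Poly_Mapping.single m a)"
    and add: "\<And>f g. P f \<Longrightarrow> P g \<Longrightarrow> P (f + g)"
  shows "P f"
proof -
  have "P (\<Sum>m\<in>A. Poly_Mapping.single m (Poly_Mapping.lookup f m))" if "finite A" for A
    using that
  proof induction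
    case empty
    then show ?case using single[of undefined 0] by simp
  qed (auto intro: single add)
  from this[of "Poly_Mapping.keys f"] show ?thesis
    by (simp flip: poly_mapping_eq_sum_single)
qed

lemma Const_0 [simp]: "Const 0 = 0"
  and Const_1 [simp]: "Const 1 = 1"
  and Const_add: "Const (a + b) = Const a + Const b"
  and Const_mult: "Const (c * d) = Const c * Const d"
  for a b :: "'k::monoid_add" and c d :: "'l::semiring_0"
  by (simp_all add: Const_def single_add mult_single)

lemma Const_sum: "Const (sum f A) = (\<Sum>i\<in>A. Const (f i))"
  for f :: "'a \<Rightarrow> 'k::comm_monoid_add"
  by (induction A rule: infinite_finite_induct) (simp_all add: Const_add)

lemma Const_uminus: "Const (- a) = - Const a" for a :: "'k::ab_group_add"
  by (simp add: Const_def single_uminus)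

lemma Const_of_nat: "Const (of_nat k) = of_nat k"
  by (simp add: Const_def)

lemma Const_eq_0_iff [simp]: "Const a = 0 \<longleftrightarrow> a = 0"
  by (metis Const_def lookup_single_eq lookup_zero single_zero)

lemma prod_single_one:
  fixes f :: "'i \<Rightarrow> 'a::comm_monoid_add"
  shows "(\<Prod>i\<in>A. Poly_Mapping.single (f i) (1::'k::comm_semiring_1)) = Poly_Mapping.single (sum f A) 1"
  by (induction A rule: infinite_finite_induct) (simp_all add: mult_single)

lemma Var_power: "Var i ^ k = Poly_Mapping.single (Poly_Mapping.single i k) (1::'k::comm_semiring_1)"
  by (induction k) (simp_all add: Var_def mult_single flip: single_add)

lemma single_eq_Const_times_Vars:
  fixes a :: "'k::comm_semiring_1" and m :: "'n::finite \<Rightarrow>\<^sub>0 nat"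
  shows "Poly_Mapping.single m a = Const a * (\<Prod>i\<in>UNIV. Var i ^ Poly_Mapping.lookup m i)"
proof -
  have "m = (\<Sum>i\<in>UNIV. Poly_Mapping.single i (Poly_Mapping.lookup m i))"
    by (rule poly_mapping_eqI) (simp add: lookup_sum lookup_single when_def)
  then show ?thesis
    by (simp add: Var_power prod_single_one Const_def mult_single)
qed

text \<open>Constants and variables generate the polynomial ring, so a homomorphism identity or the
  chain rule has to be checked on these generators only.\<close>

lemma mpoly_induct [case_names Const Var add mult]:
  fixes f :: "('k::comm_semiring_1, 'n::finite) mpoly"
  assumes Const: "\<And>a. P (Const a)" and Var: "\<And>i. P (Var i)"
    and add: "\<And>f g. P f \<Longrightarrow> P g \<Longrightarrow> P (f + g)"
    and mult: "\<And>f g. P f \<Longrightarrow> P g \<Longrightarrow> P (f * g)"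
  shows "P f"
proof (induction f rule: poly_mapping_single_induct)
  case (single m a)
  have one: "P 1" using Const[of 1] by simp
  have "P (Var i ^ k)" for i k
    by (induction k) (auto intro: one mult Var)
  then have "P (\<Prod>i\<in>A. Var i ^ Poly_Mapping.lookup m i)" for A
    by (induction A rule: infinite_finite_induct) (auto intro: one mult)
  then show ?case
    by (simp add: single_eq_Const_times_Vars Const mult)
qed (rule add)

text \<open>Covers three uses of the same rules: the identity for values at points,
  \<open>Const\<close> for substitution of polynomial maps, and later a substitution itself as a
  ring homomorphism applied to the entries of a matrix.\<close>

locale coefficient_hom =
  fixes \<phi> :: "'k::comm_semiring_1 \<Rightarrow> 'r::comm_semiring_1"
  assumes zero: "\<phi> 0 = 0" and one: "\<phi> 1 = 1"
    and add: "\<phi> (a + b) = \<phi> a + \<phi> b" and mult: "\<phi> (a * b) = \<phi> a * \<phi> b"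
begin

lemma eval_eq_sum:
  assumes "finite S" "Poly_Mapping.keys f \<subseteq> S"
  shows "mpoly_eval \<phi> g f =
    (\<Sum>m\<in>S. \<phi> (Poly_Mapping.lookup f m) * (\<Prod>i\<in>UNIV. (g $ i) ^ Poly_Mapping.lookup m i))"
  unfolding mpoly_eval_def
  by (rule sum.mono_neutral_left) (use assms in \<open>auto simp: in_keys_iff zero\<close>)

lemma eval_single:
  "mpoly_eval \<phi> g (Poly_Mapping.single m a) = \<phi> a * (\<Prod>i\<in>UNIV. (g $ i) ^ Poly_Mapping.lookup m i)"
  by (subst eval_eq_sum[of "{m}"]) simp_all

lemma eval_add: "mpoly_eval \<phi> g (f + f') = mpoly_eval \<phi> g f + mpoly_eval \<phi> g f'"
proof -
  let ?S = "Poly_Mapping.keys f \<union> Poly_Mapping.keys f'"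
  show ?thesis
    using keys_add[of f f']
    by (simp add: eval_eq_sum[of ?S] lookup_add add distrib_right sum.distrib)
qed

lemma eval_mult: "mpoly_eval \<phi> g (f * f') = mpoly_eval \<phi> g f * mpoly_eval \<phi> g f'"
proof (induction f rule: poly_mapping_single_induct)
  case (single m a)
  show ?case
  proof (induction f' rule: poly_mapping_single_induct)
    case (single m' b)
    show ?case
      by (simp add: mult_single eval_single lookup_add power_add prod.distrib mult ac_simps)
  qed (simp add: eval_add distrib_left)
qed (simp add: distrib_right eval_add)

lemma eval_Const [simp]: "mpoly_eval \<phi> g (Const a) = \<phi> a"
  by (simp add: Const_def eval_single)

lemma eval_0 [simp]: "mpoly_eval \<phi> g 0 = 0" and eval_1 [simp]: "mpoly_eval \<phi> g 1 = 1"
  using eval_Const[of g 0] eval_Const[of g 1] by (simp_all add: zero one)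

lemma eval_Var [simp]: "mpoly_eval \<phi> g (Var i) = g $ i"
proof -
  have "(\<Prod>j\<in>UNIV. (g $ j) ^ Poly_Mapping.lookup (Poly_Mapping.single i 1) j) =
      (\<Prod>j\<in>UNIV. if j = i then g $ i else 1)"
    by (rule prod.cong) (auto simp: lookup_single when_def)
  then show ?thesis
    by (simp add: Var_def eval_single one)
qed

lemma eval_sum: "mpoly_eval \<phi> g (sum F A) = (\<Sum>i\<in>A. mpoly_eval \<phi> g (F i))"
  by (induction A rule: infinite_finite_induct) (simp_all add: eval_add)

lemma eval_power: "mpoly_eval \<phi> g (f ^ k) = mpoly_eval \<phi> g f ^ k"
  by (induction k) (simp_all add: eval_mult)

text \<open>Both sides are homomorphisms in \<open>f\<close> that agree on generators. With
  \<open>Const\<close> for \<open>\<phi>\<close> this is the associativity of substitution.\<close>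

lemma eval_eval_Const:
  "mpoly_eval \<phi> g (mpoly_eval Const G f) = mpoly_eval \<phi> (\<chi> i. mpoly_eval \<phi> g (G $ i)) f"
proof -
  interpret C: coefficient_hom Const
    by standard (simp_all add: Const_add Const_mult)
  show ?thesis
    by (induction f rule: mpoly_induct) (simp_all add: C.eval_add C.eval_mult eval_add eval_mult)
qed

end

interpretation ident: coefficient_hom "\<lambda>a. a"
  by standard simp_all

interpretation subst: coefficient_hom Const
  by standard (simp_all add: Const_add Const_mult)

section \<open>Formal partial derivatives\<close>

lemma lookup_partial_deriv:
  fixes f :: "('k::comm_semiring_1, 'n) mpoly"
  shows "Poly_Mapping.lookup (partial_deriv j f) m =
    of_nat (Suc (Poly_Mapping.lookup m j)) * Poly_Mapping.lookup f (m + Poly_Mapping.single j 1)"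
proof -
  let ?e = "Poly_Mapping.single j (1::nat)"
  \<comment> \<open>Truncated subtraction is not injective: an exponent \<open>k\<close> without the
    variable j is left unchanged and could collide with another one. Its coefficient carries the
    factor 0, so the collision is harmless.\<close>
  have *: "Poly_Mapping.lookup (Poly_Mapping.single (k - ?e) (of_nat (Poly_Mapping.lookup k j) * a)) m =
      (if k = m + ?e then of_nat (Poly_Mapping.lookup k j) * a else 0)" for k and a :: 'k
  proof (cases "Poly_Mapping.lookup k j = 0")
    case True
    then show ?thesis by (auto simp: lookup_add)
  next
    case False
    then have "(k - ?e) + ?e = k"
      by (intro poly_mapping_eqI) (auto simp: lookup_add lookup_minus lookup_single when_def)
    then have "k - ?e = m \<longleftrightarrow> k = m + ?e" by (metis add_diff_cancel_right')
    then show ?thesis by (auto simp: lookup_single when_def)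
  qed
  show ?thesis
    unfolding partial_deriv_def lookup_sum *
    by (simp add: in_keys_iff lookup_add)
qed

lemma partial_deriv_add: "partial_deriv j (f + g) = partial_deriv j f + partial_deriv j g"
  by (rule poly_mapping_eqI) (simp add: lookup_partial_deriv lookup_add distrib_left)

lemma partial_deriv_0 [simp]: "partial_deriv j 0 = 0"
  by (simp add: partial_deriv_def)

lemma partial_deriv_sum: "partial_deriv j (sum f A) = (\<Sum>i\<in>A. partial_deriv j (f i))"
  by (induction A rule: infinite_finite_induct) (simp_all add: partial_deriv_add)

lemma partial_deriv_single:
  "partial_deriv j (Poly_Mapping.single m a) =
    Poly_Mapping.single (m - Poly_Mapping.single j 1) (of_nat (Poly_Mapping.lookup m j) * a)"
  by (simp add: partial_deriv_def)

lemma partial_deriv_mult: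
  "partial_deriv j (f * g) = partial_deriv j f * g + f * partial_deriv j g"
proof (induction f rule: poly_mapping_single_induct)
  case (single m a)
  show ?case
  proof (induction g rule: poly_mapping_single_induct)
    case (single m' b)
    let ?e = "Poly_Mapping.single j (1::nat)"
    have l: "m - ?e + m' = m + m' - ?e" if "Poly_Mapping.lookup m j \<noteq> 0"
      by (rule poly_mapping_eqI) (use that in \<open>auto simp: lookup_add lookup_minus lookup_single when_def\<close>)
    have r: "m + (m' - ?e) = m + m' - ?e" if "Poly_Mapping.lookup m' j \<noteq> 0"
      by (rule poly_mapping_eqI) (use that in \<open>auto simp: lookup_add lookup_minus lookup_single when_def\<close>)
    show ?case
      using l r
      by (cases "Poly_Mapping.lookup m j = 0"; cases "Poly_Mapping.lookup m' j = 0")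
        (simp_all add: mult_single partial_deriv_single lookup_add algebra_simps
          flip: single_add)
  qed (simp add: partial_deriv_add algebra_simps)
qed (simp add: partial_deriv_add algebra_simps)

lemma partial_deriv_Const [simp]: "partial_deriv j (Const a) = 0"
  by (simp add: Const_def partial_deriv_single)

lemma partial_deriv_1 [simp]: "partial_deriv j 1 = 0"
  using partial_deriv_Const[of j 1] by simp

lemma partial_deriv_Var: "partial_deriv j (Var i) = (if i = j then 1 else 0)"
  by (simp add: Var_def partial_deriv_single lookup_single when_def)

lemma partial_deriv_power:
  "partial_deriv j (f ^ k) = of_nat k * f ^ (k - 1) * partial_deriv j f"
proof (induction k)
  case (Suc k)
  then show ?case
    by (cases k) (simp_all add: partial_deriv_mult algebra_simps)
qed simp

text \<open>In characteristic zero a positive exponent is a nonzero factor, so differentiation by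
  x_j destroys no monomial that contains x_j. This turns vanishing Jacobian entries into absence of
  variables.\<close>

lemma partial_deriv_eq_0_iff:
  fixes f :: "('k::field_char_0, 'n) mpoly"
  shows "partial_deriv j f = 0 \<longleftrightarrow> (\<forall>m\<in>Poly_Mapping.keys f. Poly_Mapping.lookup m j = 0)"
proof
  assume 0: "partial_deriv j f = 0"
  show "\<forall>m\<in>Poly_Mapping.keys f. Poly_Mapping.lookup m j = 0"
  proof (intro ballI, rule ccontr)
    fix m assume m: "m \<in> Poly_Mapping.keys f" and "Poly_Mapping.lookup m j \<noteq> 0"
    then have "m - Poly_Mapping.single j 1 + Poly_Mapping.single j 1 = m"
      by (intro poly_mapping_eqI) (auto simp: lookup_add lookup_minus lookup_single when_def)
    then have "Poly_Mapping.lookup f m = 0"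
      using lookup_partial_deriv[of j f "m - Poly_Mapping.single j 1"] 0
      by (metis lookup_zero mult_eq_0_iff of_nat_neq_0)
    with m show False by (simp add: in_keys_iff)
  qed
next
  assume "\<forall>m\<in>Poly_Mapping.keys f. Poly_Mapping.lookup m j = 0"
  then have "Poly_Mapping.lookup f (m + Poly_Mapping.single j 1) = 0" for m
    by (metis One_nat_def add_is_0 in_keys_iff lookup_add lookup_single_eq nat.distinct(1))
  then show "partial_deriv j f = 0"
    by (intro poly_mapping_eqI) (simp add: lookup_partial_deriv)
qed

section \<open>Linear changes of coordinates\<close>

lemma
  fixes A :: "'a::semiring_1 ^ 'n::finite ^ 'n"
  assumes "invertible A"
  shows matrix_inv_right: "A ** matrix_inv A = mat 1"
    and matrix_inv_left: "matrix_inv A ** A = mat 1"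
  using someI_ex[OF assms[unfolded invertible_def]] by (simp_all add: matrix_inv_def)

lemma matrix_inv_unique:
  fixes A B :: "'a::semiring_1 ^ 'n::finite ^ 'n"
  assumes "A ** B = mat 1" "B ** A = mat 1"
  shows "matrix_inv A = B"
proof -
  have "invertible A" using assms by (auto simp: invertible_def)
  then have "matrix_inv A ** A = mat 1" by (rule matrix_inv_left)
  then have "matrix_inv A ** (A ** B) = B" by (simp add: matrix_mul_assoc)
  then show ?thesis by (simp add: assms)
qed

lemma
  fixes A :: "'a::semiring_1 ^ 'n::finite ^ 'n"
  assumes "invertible A"
  shows invertible_matrix_inv: "invertible (matrix_inv A)"
    and matrix_inv_matrix_inv: "matrix_inv (matrix_inv A) = A"
  using matrix_inv_left[OF assms] matrix_inv_right[OF assms]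
  by (auto simp: invertible_def intro: matrix_inv_unique)

lemma matrix_inv_mult:
  fixes A B :: "'a::semiring_1 ^ 'n::finite ^ 'n"
  assumes "invertible A" "invertible B"
  shows "matrix_inv (A ** B) = matrix_inv B ** matrix_inv A"
proof (rule matrix_inv_unique)
  have "A ** B ** (matrix_inv B ** matrix_inv A) = A ** (B ** matrix_inv B) ** matrix_inv A"
    by (simp only: matrix_mul_assoc)
  then show "A ** B ** (matrix_inv B ** matrix_inv A) = mat 1"
    by (simp add: matrix_inv_right assms)
  have "matrix_inv B ** matrix_inv A ** (A ** B) = matrix_inv B ** (matrix_inv A ** A) ** B"
    by (simp only: matrix_mul_assoc)
  then show "matrix_inv B ** matrix_inv A ** (A ** B) = mat 1"
    by (simp add: matrix_inv_left assms)
qed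

section \<open>Linear forms and conjugation by linear maps\<close>

definition lform :: "'k::comm_semiring_1 ^ 'n::finite \<Rightarrow> ('k, 'n) mpoly" where
  "lform c = (\<Sum>s\<in>UNIV. Const (c $ s) * Var s)"

lemma power_map_nth: "power_map c e b $ r = lform c ^ e * Const (b $ r)"
  by (simp add: power_map_def lform_def)

lemma linear_map_nth: "linear_map A $ i = lform (A $ i)"
  by (simp add: linear_map_def lform_def matrix_vector_mult_def id_map_def)

lemma lform_0 [simp]: "lform 0 = 0"
  by (simp add: lform_def)

lemma lform_add: "lform (a + b) = lform a + lform b"
  by (simp add: lform_def Const_add distrib_right sum.distrib)

lemma lform_scale: "lform (t *s a) = Const t * lform a"
  by (simp add: lform_def Const_mult sum_distrib_left mult.assoc)

lemma partial_deriv_lform: "partial_deriv j (lform c) = Const (c $ j)"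
proof -
  have "partial_deriv j (lform c) = (\<Sum>s\<in>UNIV. if s = j then Const (c $ s) else 0)"
    unfolding lform_def partial_deriv_sum
    by (rule sum.cong) (auto simp: partial_deriv_mult partial_deriv_Var)
  then show ?thesis by simp
qed

lemma lform_eq_0_iff: "lform c = 0 \<longleftrightarrow> c = 0"
  using partial_deriv_lform[of _ c] by (auto simp: vec_eq_iff lform_def)

lemma subst_lform:
  "mpoly_eval Const (linear_map T) (lform c) = lform (c v* T)"
proof -
  have "mpoly_eval Const (linear_map T) (lform c) =
      (\<Sum>s\<in>UNIV. \<Sum>t\<in>UNIV. Const (c $ s) * (Const (T $ s $ t) * Var t))"
    unfolding lform_def subst.eval_sum
    by (simp add: subst.eval_mult linear_map_nth lform_def sum_distrib_left)
  also have "\<dots> = (\<Sum>t\<in>UNIV. \<Sum>s\<in>UNIV. Const (c $ s) * (Const (T $ s $ t) * Var t))"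
    by (rule sum.swap)
  also have "\<dots> = lform (c v* T)"
    by (simp add: lform_def vector_matrix_mult_def Const_sum Const_mult
        sum_distrib_right sum_distrib_left ac_simps)
  finally show ?thesis .
qed

lemma subst_linear_map_mat_1:
  fixes f :: "('k::comm_semiring_1, 'n::finite) mpoly"
  shows "mpoly_eval Const (linear_map (mat 1)) f = f"
proof -
  have "lform (mat 1 $ i) = (Var i :: ('k, 'n) mpoly)" for i
    by (simp add: lform_def mat_def if_distrib[of Const] if_distrib[of "\<lambda>x. x * _"] cong: if_cong)
  then show ?thesis
    by (induction f rule: mpoly_induct) (simp_all add: subst.eval_add subst.eval_mult linear_map_nth)
qed

lemma subst_subst_linear_map:
  "mpoly_eval Const (linear_map T) (mpoly_eval Const (linear_map S) f) =
    mpoly_eval Const (linear_map (S ** T)) f"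
proof -
  have "(\<chi> i. mpoly_eval Const (linear_map T) (linear_map S $ i)) = linear_map (S ** T)"
  proof -
    have "S $ i v* T = (S ** T) $ i" for i
      by (simp add: vec_eq_iff vector_matrix_mult_def matrix_matrix_mult_def mult.commute)
    then have "lform (S $ i v* T) = lform ((S ** T) $ i)" for i by simp
    then show ?thesis by (simp add: vec_eq_iff linear_map_nth subst_lform)
  qed
  then show ?thesis by (simp add: subst.eval_eval_Const)
qed

lemma conj_map_nth:
  "conj_map T H $ r =
    (\<Sum>k\<in>UNIV. Const (matrix_inv T $ r $ k) * mpoly_eval Const (linear_map T) (H $ k))"
  by (simp add: conj_map_def matrix_vector_mult_def polymap_comp_def)

lemma conj_map_mat_1:
  fixes H :: "('k::comm_semiring_1, 'n::finite) polymap"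
  shows "conj_map (mat 1) H = H"
proof -
  have "matrix_inv (mat 1 :: 'k^'n^'n) = mat 1"
    by (rule matrix_inv_unique) simp_all
  then show ?thesis
    by (simp add: vec_eq_iff conj_map_nth subst_linear_map_mat_1)
      (simp add: mat_def if_distrib[of Const] if_distrib[of "\<lambda>x. x * _"] cong: if_cong)
qed

lemma conj_map_conj_map:
  assumes "invertible S" "invertible T"
  shows "conj_map T (conj_map S H) = conj_map (S ** T) H"
proof -
  have "conj_map T (conj_map S H) $ r = conj_map (S ** T) H $ r" for r
  proof -
    let ?h = "\<lambda>k. mpoly_eval Const (linear_map (S ** T)) (H $ k)"
    have "conj_map T (conj_map S H) $ r =
        (\<Sum>k\<in>UNIV. \<Sum>l\<in>UNIV. Const (matrix_inv T $ r $ k * matrix_inv S $ k $ l) * ?h l)"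
      by (simp add: conj_map_nth subst.eval_sum subst.eval_mult subst_subst_linear_map
          sum_distrib_left Const_mult mult.assoc)
    also have "\<dots> = (\<Sum>l\<in>UNIV. \<Sum>k\<in>UNIV. Const (matrix_inv T $ r $ k * matrix_inv S $ k $ l) * ?h l)"
      by (rule sum.swap)
    also have "\<dots> = (\<Sum>l\<in>UNIV. Const ((matrix_inv T ** matrix_inv S) $ r $ l) * ?h l)"
      by (simp add: matrix_matrix_mult_def[of "matrix_inv T"] Const_sum sum_distrib_right)
    also have "\<dots> = conj_map (S ** T) H $ r"
      by (simp add: conj_map_nth matrix_inv_mult assms)
    finally show ?thesis .
  qed
  then show ?thesis by (simp add: vec_eq_iff)
qed

lemma conj_map_matrix_inv:
  assumes "invertible T"
  shows "conj_map (matrix_inv T) (conj_map T H) = H"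
  using assms
  by (simp add: conj_map_conj_map invertible_matrix_inv matrix_inv_right conj_map_mat_1)

lemma conj_map_sum: "conj_map T (sum F A) = (\<Sum>i\<in>A. conj_map T (F i))"
proof -
  have "conj_map T (sum F A) $ r = (\<Sum>i\<in>A. conj_map T (F i) $ r)" for r
    by (simp add: conj_map_nth subst.eval_sum sum_distrib_left) (rule sum.swap)
  then show ?thesis by (simp add: vec_eq_iff)
qed

text \<open>Here \<open>c v* T\<close> is T^t c: covectors and vectors transform oppositely, and the
  exponent stays. So conjugation maps sums of N terms to sums of N terms.\<close>

lemma conj_map_power_map:
  "conj_map T (power_map c e b) = power_map (c v* T) e (matrix_inv T *v b)"
  by (simp add: vec_eq_iff conj_map_nth power_map_nth subst.eval_mult subst.eval_power subst_lform
      matrix_vector_mult_def[of "matrix_inv T"] Const_sum Const_mult sum_distrib_left ac_simps)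

lemma partial_deriv_subst:
  "partial_deriv j (mpoly_eval Const (linear_map T) f) =
    (\<Sum>i\<in>UNIV. mpoly_eval Const (linear_map T) (partial_deriv i f) * Const (T $ i $ j))"
proof (induction f rule: mpoly_induct)
  case (Var i)
  have "(\<Sum>k\<in>UNIV. mpoly_eval Const (linear_map T) (partial_deriv k (Var i)) * Const (T $ k $ j)) =
      (\<Sum>k\<in>UNIV. if k = i then Const (T $ i $ j) else 0)"
    by (rule sum.cong) (auto simp: partial_deriv_Var)
  then show ?case by (simp add: linear_map_nth partial_deriv_lform)
next
  case (mult f g)
  then show ?case
    by (simp add: subst.eval_add subst.eval_mult partial_deriv_mult sum.distrib
        sum_distrib_left sum_distrib_right algebra_simps)
qed (simp_all add: subst.eval_add partial_deriv_add sum.distrib distrib_right)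

text \<open>The chain rule: the Jacobian of T^-1 H(Tx) is T^-1 times the Jacobian of H taken at Tx,
  times T.\<close>

lemma jacobian_matrix_conj_map:
  "jacobian_matrix (conj_map T H) =
    map_matrix Const (matrix_inv T) **
      (map_matrix (mpoly_eval Const (linear_map T)) (jacobian_matrix H) ** map_matrix Const T)"
  by (simp add: vec_eq_iff jacobian_matrix_def conj_map_nth partial_deriv_sum partial_deriv_mult
      partial_deriv_subst matrix_matrix_mult_def)

lemma scalar_product_transform:
  fixes T :: "'k::comm_semiring_1 ^ 'n::finite ^ 'n"
  assumes "invertible T"
  shows "scalar_product (c v* T) (matrix_inv T *v b) = scalar_product c b"
proof -
  have "scalar_product (c v* T) v = scalar_product c (T *v v)" for v
  proof -
    have "scalar_product (c v* T) v = (\<Sum>i\<in>UNIV. \<Sum>j\<in>UNIV. T $ j $ i * c $ j * v $ i)"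
      by (simp add: scalar_product_def vector_matrix_mult_def sum_distrib_left sum_distrib_right ac_simps)
    also have "\<dots> = (\<Sum>j\<in>UNIV. \<Sum>i\<in>UNIV. T $ j $ i * c $ j * v $ i)"
      by (rule sum.swap)
    also have "\<dots> = scalar_product c (T *v v)"
      by (simp add: scalar_product_def matrix_vector_mult_def sum_distrib_left ac_simps)
    finally show ?thesis .
  qed
  then show ?thesis
    by (simp add: matrix_vector_mul_assoc matrix_inv_right assms)
qed

lemma star_representation_conj_map:
  assumes "invertible T" "star_representation d N b c e H"
  shows "star_representation d N (\<lambda>i. matrix_inv T *v b i) (\<lambda>i. c i v* T) e (conj_map T H)"
  using assms
  by (simp add: star_representation_def scalar_product_transform conj_map_sum conj_map_power_map)

lemma star_representation_from_conj_map:
  assumes "invertible T" "star_representation d N b c e (conj_map T H)"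
  shows "star_representation d N (\<lambda>i. T *v b i) (\<lambda>i. c i v* matrix_inv T) e H"
  using star_representation_conj_map[OF invertible_matrix_inv[OF assms(1)] assms(2)] assms(1)
  by (simp add: matrix_inv_matrix_inv conj_map_matrix_inv)

section \<open>Degrees\<close>

lemma mon_degree_add: "mon_degree (m + m') = mon_degree m + mon_degree m'"
  by (simp add: mon_degree_def lookup_add sum.distrib)

lemma mon_degree_single: "mon_degree (Poly_Mapping.single i k) = k"
  by (simp add: mon_degree_def lookup_single when_def)

lemma mon_degree_eq_0_iff: "mon_degree m = 0 \<longleftrightarrow> m = 0"
  by (auto simp: mon_degree_def intro: poly_mapping_eqI)

text \<open>A set of admissible degrees instead of a bound: \<open>{k}\<close> expresses homogeneity
  and \<open>{1..d}\<close> the situation of the theorem, and both are stable under the same linear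
  operations.\<close>

definition degrees_in :: "nat set \<Rightarrow> ('k::zero, 'n::finite) mpoly \<Rightarrow> bool" where
  "degrees_in D f \<longleftrightarrow> (\<forall>m\<in>Poly_Mapping.keys f. mon_degree m \<in> D)"

lemma homogeneous_iff_degrees_in: "homogeneous k f \<longleftrightarrow> degrees_in {k} f"
  by (simp add: homogeneous_def degrees_in_def)

lemma homogeneous_imp_degrees_in: "homogeneous k f \<Longrightarrow> k \<in> D \<Longrightarrow> degrees_in D f"
  by (auto simp: homogeneous_def degrees_in_def)

lemma degrees_in_0 [simp]: "degrees_in D 0"
  by (simp add: degrees_in_def)

lemma degrees_in_add: "degrees_in D f \<Longrightarrow> degrees_in D g \<Longrightarrow> degrees_in D (f + g)"
  unfolding degrees_in_def using keys_add[of f g] by blast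

lemma degrees_in_sum: "(\<And>i. i \<in> A \<Longrightarrow> degrees_in D (f i)) \<Longrightarrow> degrees_in D (sum f A)"
  by (induction A rule: infinite_finite_induct) (auto intro: degrees_in_add)

lemma homogeneous_mult: "homogeneous k f \<Longrightarrow> homogeneous l g \<Longrightarrow> homogeneous (k + l) (f * g)"
  unfolding homogeneous_def using keys_mult[of f g] by (force simp: mon_degree_add)

lemma homogeneous_Const: "homogeneous 0 (Const a)"
  by (auto simp: homogeneous_def Const_def mon_degree_eq_0_iff split: if_splits)

lemma homogeneous_1: "homogeneous 0 (1 :: ('k::zero_neq_one, 'n::finite) mpoly)"
  by (simp add: homogeneous_def mon_degree_eq_0_iff)

lemma homogeneous_power: "homogeneous k f \<Longrightarrow> homogeneous (j * k) (f ^ j)"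
  for f :: "('k::comm_semiring_1, 'n::finite) mpoly"
  by (induction j) (auto intro: homogeneous_mult homogeneous_1)

lemma homogeneous_prod:
  fixes f :: "'i \<Rightarrow> ('k::comm_semiring_1, 'n::finite) mpoly"
  assumes "\<And>i. i \<in> A \<Longrightarrow> homogeneous (k i) (f i)"
  shows "homogeneous (sum k A) (prod f A)"
  using assms
  by (induction A rule: infinite_finite_induct) (auto intro: homogeneous_mult homogeneous_1)

lemma homogeneous_Var: "homogeneous 1 (Var i)"
  by (auto simp: homogeneous_def Var_def mon_degree_single)

lemma homogeneous_lform: "homogeneous 1 (lform c)"
  unfolding lform_def homogeneous_iff_degrees_in
  by (intro degrees_in_sum)
    (metis homogeneous_iff_degrees_in homogeneous_mult homogeneous_Const homogeneous_Var add_0)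

lemma homogeneous_lform_power: "homogeneous k (lform c ^ k)"
  using homogeneous_power[OF homogeneous_lform, of k c] by simp

lemma degrees_in_Const_mult:
  assumes "degrees_in D f"
  shows "degrees_in D (Const a * f)"
  unfolding degrees_in_def
proof
  fix m assume "m \<in> Poly_Mapping.keys (Const a * f)"
  then obtain m' where "m' \<in> Poly_Mapping.keys f" "m = m'"
    using keys_mult[of "Const a" f] by (auto simp: Const_def split: if_splits)
  then show "mon_degree m \<in> D" using assms by (auto simp: degrees_in_def)
qed

text \<open>A linear substitution turns a monomial of degree k into a product of k linear forms,
  which is again homogeneous of degree k.\<close>

lemma degrees_in_subst:
  assumes "degrees_in D f"
  shows "degrees_in D (mpoly_eval Const (linear_map T) f)"
  unfolding mpoly_eval_def
proof (intro degrees_in_sum degrees_in_Const_mult)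
  fix m assume "m \<in> Poly_Mapping.keys f"
  then have "mon_degree m \<in> D" using assms by (simp add: degrees_in_def)
  moreover have "homogeneous (mon_degree m) (\<Prod>i\<in>UNIV. (linear_map T $ i) ^ Poly_Mapping.lookup m i)"
    unfolding mon_degree_def
    by (intro homogeneous_prod) (simp add: linear_map_nth homogeneous_lform_power)
  ultimately show "degrees_in D (\<Prod>i\<in>UNIV. (linear_map T $ i) ^ Poly_Mapping.lookup m i)"
    by (rule homogeneous_imp_degrees_in[rotated])
qed

lemma degrees_in_conj_map:
  assumes "\<And>i. degrees_in D (H $ i)"
  shows "degrees_in D (conj_map T H $ r)"
  unfolding conj_map_nth
  by (intro degrees_in_sum degrees_in_Const_mult degrees_in_subst assms)

lemma polymap_apply_0_nth: "polymap_apply F 0 $ i = Poly_Mapping.lookup (F $ i) 0"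
  for F :: "('k::comm_semiring_1, 'n::finite) polymap"
proof -
  have *: "(\<Prod>j\<in>UNIV. (0::'k) ^ Poly_Mapping.lookup m j) = (if m = 0 then 1 else 0)"
    for m :: "'n \<Rightarrow>\<^sub>0 nat"
  proof (cases "m = 0")
    case False
    then obtain j where "Poly_Mapping.lookup m j \<noteq> 0"
      by (metis poly_mapping_eqI lookup_zero)
    then have "\<exists>j\<in>UNIV. (0::'k) ^ Poly_Mapping.lookup m j = 0"
      by (intro bexI[of _ j]) (auto simp: zero_power_eq)
    then show ?thesis using False prod_zero[of UNIV "\<lambda>j. (0::'k) ^ Poly_Mapping.lookup m j"] by simp
  qed simp
  have "polymap_apply F 0 $ i =
      (\<Sum>m\<in>Poly_Mapping.keys (F $ i). if m = 0 then Poly_Mapping.lookup (F $ i) m else 0)"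
    unfolding polymap_apply_def mpoly_eval_def zero_index vec_lambda_beta *
    by (rule sum.cong) auto
  then show ?thesis by (simp add: in_keys_iff)
qed

text \<open>The degree is that of x+H, so a monomial of H might be cancelled by x. A cancelled
  monomial is the variable itself, of degree 1, which is at most d. The lower bound 1 comes from
  H(0) = 0.\<close>

lemma degrees_in_if_polymap_degree:
  fixes H :: "('k::comm_ring_1, 'n::finite) polymap"
  assumes "polymap_degree (id_map + H) = d" "d \<ge> 1" "polymap_apply H 0 = 0"
  shows "degrees_in {1..d} (H $ i)"
  unfolding degrees_in_def
proof
  fix m assume m: "m \<in> Poly_Mapping.keys (H $ i)"
  have "m \<noteq> 0"
    using m polymap_apply_0_nth[of H i] assms(3) by (auto simp: in_keys_iff)
  then have "1 \<le> mon_degree m"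
    using mon_degree_eq_0_iff[of m] by linarith
  moreover have "mon_degree m \<le> d"
  proof (cases "m \<in> Poly_Mapping.keys (Var i + H $ i)")
    case True
    then have "mon_degree m \<le> total_degree ((id_map + H) $ i)"
      by (simp add: total_degree_def id_map_def)
    also have "\<dots> \<le> polymap_degree (id_map + H)"
      by (simp add: polymap_degree_def)
    finally show ?thesis using assms(1) by simp
  next
    case False
    then have "m \<in> Poly_Mapping.keys (Var i :: ('k, 'n) mpoly)"
      using m by (auto simp: in_keys_iff lookup_add)
    moreover have "homogeneous 1 (Var i :: ('k, 'n) mpoly)"
      by (rule homogeneous_Var)
    ultimately show ?thesis using assms(2) by (auto simp: homogeneous_def)
  qed
  ultimately show "mon_degree m \<in> {1..d}" by simp
qed

section \<open>Monomials as combinations of powers of linear forms\<close>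

text \<open>The coefficients of a polynomial in \<open>t\<close> are combinations of its values: replacing \<open>p(t)\<close> by
  \<open>p(2t) - 2\<^sup>m p(t)\<close> removes the term of degree \<open>m\<close> and rescales the others by nonzero factors.\<close>

lemma coefficients_in_subspace:
  fixes v :: "nat \<Rightarrow> ('k::field_char_0, 'n::finite) mpoly"
  assumes add: "\<And>f g. f \<in> W \<Longrightarrow> g \<in> W \<Longrightarrow> f + g \<in> W"
    and scale: "\<And>a f. f \<in> W \<Longrightarrow> Const a * f \<in> W"
    and all_values: "\<And>t. (\<Sum>k\<le>m. Const (t ^ k) * v k) \<in> W"
    and "k \<le> m"
  shows "v k \<in> W"
  using all_values \<open>k \<le> m\<close>
proof (induction m arbitrary: v k)
  case 0
  then show ?case using "0.prems"(1)[of 1] by simp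
next
  case (Suc m)
  let ?p = "\<lambda>t. \<Sum>k\<le>Suc m. Const (t ^ k) * v k"
  let ?d = "\<lambda>k. 2 ^ k - 2 ^ Suc m :: 'k"
  have "(\<Sum>k\<le>m. Const (t ^ k) * (Const (?d k) * v k)) \<in> W" for t
  proof -
    have "?p (2 * t) + Const (- (2 ^ Suc m)) * ?p t =
        (\<Sum>k\<le>Suc m. Const (t ^ k) * (Const (?d k) * v k))"
    proof -
      have "Const ((2 * t) ^ k) * v k + Const (- (2 ^ Suc m)) * (Const (t ^ k) * v k) =
          Const (t ^ k) * (Const (?d k) * v k)" for k
      proof -
        have "Const ((2 * t) ^ k) * v k + Const (- (2 ^ Suc m)) * (Const (t ^ k) * v k) =
            Const ((2 * t) ^ k + - (2 ^ Suc m) * t ^ k) * v k"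
          by (simp only: Const_add Const_mult distrib_right mult.assoc)
        also have "(2 * t) ^ k + - (2 ^ Suc m) * t ^ k = t ^ k * ?d k"
          by (simp add: power_mult_distrib algebra_simps)
        finally show ?thesis
          by (simp only: Const_mult mult.assoc)
      qed
      then show ?thesis
        by (simp only: sum_distrib_left sum.distrib[symmetric])
    qed
    moreover have "?p (2 * t) + Const (- (2 ^ Suc m)) * ?p t \<in> W"
      by (intro add scale Suc.prems)
    ultimately show ?thesis by simp
  qed
  then have "Const (?d k) * v k \<in> W" if "k \<le> m" for k
    using Suc.IH[of "\<lambda>k. Const (?d k) * v k" k] that by blast
  then have "Const (1 / ?d k) * (Const (?d k) * v k) \<in> W" if "k \<le> m" for k
    using that scale by blast
  moreover have "Const (1 / ?d k) * (Const (?d k) * v k) = v k" if "k \<le> m" for k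
  proof -
    \<comment> \<open>The rescaling factors are invertible because distinct powers of 2 stay
      distinct in characteristic zero.\<close>
    have "(2::nat) ^ k \<noteq> 2 ^ Suc m"
      using that power_inject_exp[of "2::nat" k "Suc m"] by simp
    then have "(of_nat (2 ^ k) :: 'k) \<noteq> of_nat (2 ^ Suc m)"
      unfolding of_nat_eq_iff .
    then have "?d k \<noteq> 0" by simp
    then have "1 / ?d k * ?d k = 1" by simp
    then show ?thesis
      unfolding mult.assoc[symmetric] Const_mult[symmetric] by simp
  qed
  ultimately have low: "v k \<in> W" if "k \<le> m" for k
    using that by metis
  have sub: "f - g \<in> W" if "f \<in> W" "g \<in> W" for f g
    using add[OF that(1) scale[OF that(2), of "-1"]] by (simp add: Const_uminus)
  \<comment> \<open>The top coefficient is the value at t = 1 minus all lower coefficients, which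
    are subtracted one at a time.\<close>
  have "?p 1 - (\<Sum>k\<in>A. v k) \<in> W" if "A \<subseteq> {..m}" for A
  proof -
    have "finite A" using that finite_subset by blast
    then show ?thesis using that
    proof (induction A)
      case empty
      then show ?case using Suc.prems(1)[of 1] by simp
    next
      case (insert k A)
      then have "?p 1 - (\<Sum>k\<in>A. v k) - v k \<in> W" using insert.prems by (intro sub[OF insert.IH low]) auto
      then show ?case using insert by (simp add: algebra_simps)
    qed
  qed
  from this[of "{..m}"] have "v (Suc m) \<in> W" by simp
  then show ?case using low Suc.prems(2) le_Suc_eq by blast
qed

text \<open>\<open>J\<close> is the set of forbidden variables; for component r of a triangular map
  it will be \<open>{r..}\<close>. Adding one term at a time, with the scalar on the right as in
  \<open>power_map\<close>, allows the terms to be peeled off again by induction.\<close>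

inductive_set power_span :: "'n set \<Rightarrow> nat \<Rightarrow> ('k::comm_semiring_1, 'n::finite) mpoly set"
  for J e where
  zero: "0 \<in> power_span J e"
| step: "f \<in> power_span J e \<Longrightarrow> (\<And>j. j \<in> J \<Longrightarrow> c $ j = 0) \<Longrightarrow>
    lform c ^ e * Const a + f \<in> power_span J e"

lemma lform_power_in_power_span: "(\<And>j. j \<in> J \<Longrightarrow> c $ j = 0) \<Longrightarrow> lform c ^ e \<in> power_span J e"
  using power_span.step[OF power_span.zero, of J c e 1] by simp

lemma power_span_add: "f \<in> power_span J e \<Longrightarrow> g \<in> power_span J e \<Longrightarrow> f + g \<in> power_span J e"
  by (induction rule: power_span.induct) (auto simp: add.assoc intro: power_span.step)

lemma power_span_scale: "f \<in> power_span J e \<Longrightarrow> Const b * f \<in> power_span J e"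
proof (induction rule: power_span.induct)
  case (step f c a)
  then show ?case
    using power_span.step[OF step(3), of c "b * a"] by (simp add: Const_mult algebra_simps)
qed (simp add: power_span.zero)

text \<open>Polarization: for every scalar t the power (t x_i + c^t x)^(e+1) lies in the span, hence
  so do its coefficients with respect to t. The coefficient of t itself is (e+1) x_i (c^t x)^e, and
  e+1 is invertible.\<close>

lemma power_span_times_Var:
  fixes f :: "('k::field_char_0, 'n::finite) mpoly"
  assumes "i \<notin> J" "f \<in> power_span J e"
  shows "f * Var i \<in> power_span J (Suc e)"
  using assms(2)
proof (induction rule: power_span.induct)
  case (step f c a)
  \<comment> \<open>The coefficient of t^k in the binomial expansion of (t x_i + c^t
    x)^(e+1).\<close>
  let ?v = "\<lambda>k. of_nat (Suc e choose k) * Var i ^ k * lform c ^ (Suc e - k)"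
  have "lform (axis i 1) = (Var i :: ('k, 'n) mpoly)"
    by (simp add: lform_def axis_def if_distrib[of Const] if_distrib[of "\<lambda>x. x * _"] cong: if_cong)
  then have "(\<Sum>k\<le>Suc e. Const (t ^ k) * ?v k) = lform (t *s axis i 1 + c) ^ Suc e" for t
  proof -
    have "Const (t ^ k) = (Const t ^ k :: ('k, 'n) mpoly)" for k
      by (induction k) (simp_all add: Const_mult)
    with \<open>lform (axis i 1) = Var i\<close> show ?thesis
      unfolding lform_add lform_scale binomial_ring
      by (simp add: power_mult_distrib ac_simps del: power_Suc sum.atMost_Suc)
  qed
  moreover have "lform (t *s axis i 1 + c) ^ Suc e \<in> power_span J (Suc e)" for t
    using assms(1) step(2) by (intro lform_power_in_power_span) (auto simp: axis_def)
  ultimately have "(\<Sum>k\<le>Suc e. Const (t ^ k) * ?v k) \<in> power_span J (Suc e)" for t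
    by presburger
  then have "?v 1 \<in> power_span J (Suc e)"
    using coefficients_in_subspace[of "power_span J (Suc e)" ?v "Suc e" 1]
    by (metis power_span_add power_span_scale One_nat_def Suc_le_mono le0)
  then have "Const (1 / of_nat (Suc e)) * ?v 1 \<in> power_span J (Suc e)"
    by (rule power_span_scale)
  moreover have "Const (1 / of_nat (Suc e)) * ?v 1 = lform c ^ e * Var i"
  proof -
    have "Const (1 / of_nat (Suc e)) * of_nat (Suc e) = (1 :: ('k, 'n) mpoly)"
      unfolding Const_of_nat[symmetric] Const_mult[symmetric] by (simp del: of_nat_Suc)
    then show ?thesis
      by (simp add: mult.commute[of "Var i"] del: of_nat_Suc flip: mult.assoc)
  qed
  ultimately have "Const a * (lform c ^ e * Var i) \<in> power_span J (Suc e)"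
    by (metis power_span_scale)
  from power_span_add[OF this step(3)] show ?case by (simp add: algebra_simps)
qed (simp add: power_span.zero)

lemma power_span_times_Var_power:
  fixes f :: "('k::field_char_0, 'n::finite) mpoly"
  assumes "i \<notin> J" "f \<in> power_span J e"
  shows "f * Var i ^ k \<in> power_span J (e + k)"
proof (induction k)
  case (Suc k)
  from power_span_times_Var[OF assms(1) this] show ?case by (simp add: ac_simps)
qed (simp add: assms)

lemma single_in_power_span:
  fixes a :: "'k::field_char_0" and m :: "'n::finite \<Rightarrow>\<^sub>0 nat"
  assumes "\<And>j. j \<in> J \<Longrightarrow> Poly_Mapping.lookup m j = 0"
  shows "Poly_Mapping.single m a \<in> power_span J (mon_degree m)"
proof -
  \<comment> \<open>The start of the multiplication by variables: 1 is the 0-th power of the zero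
    form.\<close>
  have one: "(1 :: ('k, 'n) mpoly) \<in> power_span J 0"
    using lform_power_in_power_span[of J 0 0] by simp
  have "(\<Prod>i\<in>A. Var i ^ Poly_Mapping.lookup m i :: ('k, 'n) mpoly) \<in>
      power_span J (\<Sum>i\<in>A. Poly_Mapping.lookup m i)" for A
  proof (induction A rule: infinite_finite_induct)
    case (insert i A)
    show ?case
    proof (cases "i \<in> J")
      case False
      from power_span_times_Var_power[OF this insert(3)] insert(1,2) show ?thesis
        by (simp add: ac_simps)
    qed (use insert assms in simp)
  qed (simp_all add: one)
  then show ?thesis
    unfolding single_eq_Const_times_Vars mon_degree_def by (intro power_span_scale)
qed

section \<open>Strictly lower triangular matrices\<close>

text \<open>The rank, counted from 0. The indices other than the first thus have ranks 1,...,n-1,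
  which matches the numbering of n-1 terms.\<close>

definition pos :: "'n::{finite,linorder} \<Rightarrow> nat" where
  "pos i = card {..<i}"

lemma pos_less_iff: "pos i < pos j \<longleftrightarrow> i < j" for i j :: "'n::{finite,linorder}"
proof
  have less: "pos k < pos l" if "k < l" for k l :: 'n
    unfolding pos_def by (rule psubset_card_mono) (use that in auto)
  show "i < j" if "pos i < pos j"
    using that less[of j i] by (metis linorder_neqE not_less_iff_gr_or_eq)
  show "pos i < pos j" if "i < j"
    using that by (rule less)
qed

lemma pos_le_iff: "pos i \<le> pos j \<longleftrightarrow> i \<le> j"
  by (meson linorder_not_le pos_less_iff)

lemma pos_eq_iff: "pos i = pos j \<longleftrightarrow> i = j"
  by (simp add: eq_iff pos_le_iff)

lemma pos_less_CARD: "pos (i::'n::{finite,linorder}) < CARD('n)"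
  unfolding pos_def by (rule psubset_card_mono) auto

lemma bij_betw_pos: "bij_betw (pos :: 'n::{finite,linorder} \<Rightarrow> nat) UNIV {..<CARD('n)}"
proof -
  have inj: "inj (pos :: 'n \<Rightarrow> nat)" by (simp add: inj_on_def pos_eq_iff)
  moreover have "range (pos :: 'n \<Rightarrow> nat) = {..<CARD('n)}"
    by (rule card_subset_eq) (use inj in \<open>auto simp: pos_less_CARD card_image\<close>)
  ultimately show ?thesis by (simp add: bij_betw_def)
qed

lemma obtain_pos:
  assumes "k < CARD('n)"
  obtains i :: "'n::{finite,linorder}" where "pos i = k"
  using assms bij_betw_pos[where ?'n = 'n] by (metis bij_betw_iff_bijections lessThan_iff)

definition strictly_lower :: "'a::zero ^ 'n::{finite,linorder} ^ 'n::{finite,linorder} \<Rightarrow> bool" where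
  "strictly_lower A \<longleftrightarrow> (\<forall>i j. i \<le> j \<longrightarrow> A $ i $ j = 0)"

lemma strictly_lower_iff: "strictly_lower A \<longleftrightarrow> lower_triangular A \<and> zero_diagonal A"
  unfolding strictly_lower_def lower_triangular_def zero_diagonal_def by (metis order_le_less)

section \<open>Powers of triangular matrices and nilpotency\<close>

abbreviation matrix_power :: "'a::semiring_1 ^ 'n::finite ^ 'n::finite \<Rightarrow> nat \<Rightarrow> 'a ^ 'n ^ 'n" where
  "matrix_power A k \<equiv> (((**) A) ^^ k) (mat 1)"

lemma matrix_power_Suc_nth:
  "matrix_power A (Suc k) $ i $ j = (\<Sum>l\<in>UNIV. A $ i $ l * matrix_power A k $ l $ j)"
  by (simp add: matrix_matrix_mult_def[of A "matrix_power A k"])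

text \<open>Each factor moves at least one step away from the diagonal. At k = n no room is left,
  which gives nilpotency.\<close>

lemma strictly_lower_power:
  assumes "strictly_lower A" "matrix_power A k $ i $ j \<noteq> 0"
  shows "pos j + k \<le> pos i"
  using assms(2)
proof (induction k arbitrary: i)
  case 0
  then show ?case by (simp add: mat_def split: if_splits)
next
  case (Suc k)
  have "(\<Sum>l\<in>UNIV. A $ i $ l * matrix_power A k $ l $ j) \<noteq> 0"
    using Suc.prems unfolding matrix_power_Suc_nth .
  then obtain l where l: "A $ i $ l * matrix_power A k $ l $ j \<noteq> 0"
    by (meson sum.neutral)
  then have "A $ i $ l \<noteq> 0" "matrix_power A k $ l $ j \<noteq> 0" by auto
  then have "pos l < pos i" "pos j + k \<le> pos l"
    using assms(1) Suc.IH by (meson strictly_lower_def not_le pos_less_iff, blast)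
  then show ?case by simp
qed

lemma strictly_lower_imp_nilpotent:
  fixes A :: "'a::semiring_1 ^ 'n::{finite,linorder} ^ 'n::{finite,linorder}"
  assumes "strictly_lower A"
  shows "nilpotent_matrix A"
proof -
  have "matrix_power A CARD('n) $ i $ j = 0" for i j
    using strictly_lower_power[OF assms, of "CARD('n)" i j] pos_less_CARD[of i] by fastforce
  then show ?thesis by (auto simp: nilpotent_matrix_def vec_eq_iff)
qed

lemma lower_triangular_power:
  assumes "lower_triangular A"
  shows "lower_triangular (matrix_power A k)" "matrix_power A k $ i $ i = (A $ i $ i) ^ k"
proof (induction k arbitrary: i)
  case 0
  show "lower_triangular (matrix_power A 0)" "matrix_power A 0 $ i $ i = (A $ i $ i) ^ 0" for i
    by (auto simp: lower_triangular_def mat_def)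
next
  case (Suc k)
  have A: "A $ i $ j = 0" "matrix_power A k $ i $ j = 0" if "i < j" for i j
    using assms Suc.IH(1) that by (auto simp: lower_triangular_def)
  show "lower_triangular (matrix_power A (Suc k))"
    unfolding lower_triangular_def
  proof (intro allI impI)
    fix i j :: 'b assume "i < j"
    then have "A $ i $ l * matrix_power A k $ l $ j = 0" for l
      using A(1)[of i l] A(2)[of l j] by (cases "i < l") auto
    then show "matrix_power A (Suc k) $ i $ j = 0"
      by (simp only: matrix_power_Suc_nth sum.neutral_const)
  qed
  show "matrix_power A (Suc k) $ i $ i = (A $ i $ i) ^ Suc k" for i
  proof -
    have "(\<Sum>l\<in>UNIV. A $ i $ l * matrix_power A k $ l $ i) =
        (\<Sum>l\<in>UNIV. if l = i then A $ i $ i * matrix_power A k $ i $ i else 0)"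
    proof (rule sum.cong)
      fix l
      show "A $ i $ l * matrix_power A k $ l $ i =
          (if l = i then A $ i $ i * matrix_power A k $ i $ i else 0)"
        using A(1)[of i l] A(2)[of l i] by (cases l i rule: linorder_cases) auto
    qed simp
    then show ?thesis by (simp only: matrix_power_Suc_nth) (simp add: Suc.IH(2))
  qed
qed

text \<open>The diagonal of a power of a triangular matrix consists of the powers of the diagonal
  entries, and a domain has no nonzero nilpotent elements.\<close>

lemma lower_triangular_nilpotent_imp_strictly_lower:
  fixes A :: "'a::idom ^ 'n::{finite,linorder} ^ 'n::{finite,linorder}"
  assumes "lower_triangular A" "nilpotent_matrix A"
  shows "strictly_lower A"
proof -
  obtain k where k: "matrix_power A k = 0" using assms(2) by (auto simp: nilpotent_matrix_def)
  have "(A $ i $ i) ^ k = 0" for i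
    using lower_triangular_power(2)[OF assms(1), of k i] by (simp add: k)
  then have "zero_diagonal A" by (simp add: zero_diagonal_def)
  with assms(1) show ?thesis by (simp add: strictly_lower_iff)
qed

lemma (in coefficient_hom) map_matrix_mult:
  fixes A :: "'k ^ 'n::finite ^ 'm::finite"
  shows "map_matrix \<phi> (A ** B) = map_matrix \<phi> A ** map_matrix \<phi> B"
proof -
  have "\<phi> (sum f S) = (\<Sum>k\<in>S. \<phi> (f k))" for f :: "'n \<Rightarrow> 'k" and S
    by (induction S rule: infinite_finite_induct) (simp_all add: zero add)
  then show ?thesis by (simp add: vec_eq_iff matrix_matrix_mult_def mult)
qed

lemma (in coefficient_hom) map_matrix_mat_1: "map_matrix \<phi> (mat 1) = mat 1"
  by (simp add: vec_eq_iff mat_def zero one)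

lemma coefficient_hom_subst: "coefficient_hom (mpoly_eval Const G)"
  by standard (simp_all add: subst.eval_add subst.eval_mult)

text \<open>By the chain rule the Jacobian changes by a ring homomorphism on its entries (the
  substitution of Tx) and a similarity; neither affects nilpotency.\<close>

lemma nilpotent_jacobian_conj_map:
  fixes H :: "('k::comm_semiring_1, 'n::finite) polymap"
  assumes "invertible T" "nilpotent_matrix (jacobian_matrix H)"
  shows "nilpotent_matrix (jacobian_matrix (conj_map T H))"
proof -
  interpret \<sigma>: coefficient_hom "mpoly_eval Const (linear_map T)"
    by (rule coefficient_hom_subst)
  define P Q S where "P = map_matrix (Const :: 'k \<Rightarrow> ('k, 'n) mpoly) (matrix_inv T)"
    and "Q = map_matrix (Const :: 'k \<Rightarrow> ('k, 'n) mpoly) T"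
    and "S = map_matrix (mpoly_eval Const (linear_map T)) (jacobian_matrix H)"
  have J: "jacobian_matrix (conj_map T H) = P ** (S ** Q)"
    by (simp add: jacobian_matrix_conj_map P_def Q_def S_def)
  have PQ: "P ** Q = mat 1" and QP: "Q ** P = mat 1"
    using matrix_inv_left[OF assms(1)] matrix_inv_right[OF assms(1)]
    by (simp_all add: P_def Q_def subst.map_matrix_mat_1 flip: subst.map_matrix_mult)
  have "matrix_power (P ** (S ** Q)) k = P ** (matrix_power S k ** Q)" for k
  proof (induction k)
    case (Suc k)
    have "matrix_power (P ** (S ** Q)) (Suc k) = P ** (S ** Q) ** (P ** (matrix_power S k ** Q))"
      by (simp add: Suc.IH)
    also have "\<dots> = P ** (S ** (Q ** P ** (matrix_power S k ** Q)))"
      by (simp only: matrix_mul_assoc)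
    finally show ?case by (simp add: QP matrix_mul_assoc)
  qed (simp add: PQ)
  moreover obtain k where k: "matrix_power (jacobian_matrix H) k = 0"
    using assms(2) by (auto simp: nilpotent_matrix_def)
  moreover have "matrix_power S k =
      map_matrix (mpoly_eval Const (linear_map T)) (matrix_power (jacobian_matrix H) k)" for k
    by (induction k) (simp_all add: S_def \<sigma>.map_matrix_mat_1 \<sigma>.map_matrix_mult)
  ultimately have "matrix_power (P ** (S ** Q)) k = 0"
    by (simp add: k vec_eq_iff matrix_matrix_mult_def)
  then show ?thesis unfolding J nilpotent_matrix_def by blast
qed

section \<open>From upper to lower triangular by reversing the order of the variables\<close>

lemma ex_order_reversal:
  obtains \<pi> :: "'n::{finite,linorder} \<Rightarrow> 'n"
  where "\<And>i. \<pi> (\<pi> i) = i" "\<And>i j. i < j \<Longrightarrow> \<pi> j < \<pi> i"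
proof -
  have "\<exists>j :: 'n. pos j = CARD('n) - 1 - pos i" for i :: 'n
    using obtain_pos[where ?'n = 'n, of "CARD('n) - 1 - pos i"] by (metis zero_less_card_finite
        diff_less diff_right_commute less_imp_diff_less zero_less_one)
  then obtain \<pi> :: "'n \<Rightarrow> 'n" where \<pi>: "pos (\<pi> i) = CARD('n) - 1 - pos i" for i
    by metis
  show ?thesis
  proof
    have "pos (\<pi> (\<pi> i)) = pos i" for i
      using \<pi>[of i] \<pi>[of "\<pi> i"] pos_less_CARD[of i] by linarith
    then show "\<pi> (\<pi> i) = i" for i by (simp add: pos_eq_iff)
    have "pos (\<pi> j) < pos (\<pi> i)" if "i < j" for i j
      using that \<pi>[of i] \<pi>[of j] pos_less_CARD[of i] pos_less_CARD[of j]
      by (simp flip: pos_less_iff)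
    then show "\<pi> j < \<pi> i" if "i < j" for i j using that by (simp add: pos_less_iff)
  qed
qed

text \<open>Linear triangularizability admits both shapes, while the strict condition is about lower
  ones. Conjugation by the permutation matrix of the order reversal exchanges them; this matrix is
  its own inverse.\<close>

lemma conj_map_upper_to_lower:
  fixes G :: "('k::comm_semiring_1, 'n::{finite,linorder}) polymap"
  assumes "upper_triangular (jacobian_matrix G)"
  obtains P where "invertible P" "lower_triangular (jacobian_matrix (conj_map P G))"
proof -
  obtain \<pi> :: "'n \<Rightarrow> 'n" where \<pi>: "\<And>i. \<pi> (\<pi> i) = i" "\<And>i j. i < j \<Longrightarrow> \<pi> j < \<pi> i"
    by (rule ex_order_reversal) blast
  define P :: "'k ^ 'n::{finite,linorder} ^ 'n::{finite,linorder}" where "P = (\<chi> i j. if j = \<pi> i then 1 else 0)"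
  have swap: "j = \<pi> i \<longleftrightarrow> i = \<pi> j" for i j using \<pi>(1) by metis
  have PP: "P ** P = mat 1"
    by (simp add: vec_eq_iff P_def matrix_matrix_mult_def mat_def if_distrib[of "\<lambda>x. x * _"] \<pi>(1)
        cong: if_cong)
  then have inv: "matrix_inv P = P" by (rule matrix_inv_unique[OF _ PP])
  have "jacobian_matrix (conj_map P G) $ i $ j =
      mpoly_eval Const (linear_map P) (jacobian_matrix G $ \<pi> i $ \<pi> j)" for i j
  proof -
    let ?J = "\<lambda>k l. mpoly_eval Const (linear_map P) (jacobian_matrix G $ k $ l)"
    have row: "Const (P $ k $ l) = (if l = \<pi> k then 1 else 0 :: ('k, 'n) mpoly)" for k l
      by (simp add: P_def)
    then have column: "Const (P $ k $ l) = (if k = \<pi> l then 1 else 0 :: ('k, 'n) mpoly)" for k l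
      by (simp only: swap[of l k])
    have "(\<Sum>l\<in>UNIV. ?J k l * Const (P $ l $ j)) = ?J k (\<pi> j)" for k
      by (simp add: column if_distrib[of "\<lambda>x. _ * x"] cong: if_cong)
    moreover have "(\<Sum>k\<in>UNIV. Const (P $ i $ k) * ?J k (\<pi> j)) = ?J (\<pi> i) (\<pi> j)"
      by (simp add: row if_distrib[of "\<lambda>x. x * _"] cong: if_cong)
    ultimately show ?thesis
      unfolding jacobian_matrix_conj_map inv by (simp add: matrix_matrix_mult_def)
  qed
  then have "lower_triangular (jacobian_matrix (conj_map P G))"
    using assms \<pi>(2) by (simp add: lower_triangular_def upper_triangular_def)
  moreover have "invertible P" using PP by (auto simp: invertible_def)
  ultimately show ?thesis using that by blast
qed

section \<open>Adapted bases\<close>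

lemma invertible_if_independent_columns:
  fixes f :: "'n::finite \<Rightarrow> 'k::field ^ 'n"
  assumes "inj f" "vec.independent (range f)"
  shows "invertible (\<chi> r s. f s $ r)"
proof -
  have col: "column s (\<chi> r s. f s $ r) = f s" for s
    by (simp add: column_def vec_eq_iff)
  have "u i = 0" if "(\<Sum>s\<in>UNIV. u s *s f s) = 0" for u i
  proof -
    have "(\<Sum>v\<in>range f. u (inv f v) *s v) = 0"
      using that by (simp add: sum.reindex[OF assms(1)] inv_f_f[OF assms(1)])
    then have "u (inv f (f i)) = 0"
      by (rule vec.independentD[OF assms(2), rotated 2]) auto
    then show ?thesis by (simp add: inv_f_f[OF assms(1)])
  qed
  then show ?thesis
    unfolding invertible_left_inverse matrix_left_invertible_independent_columns col by blast
qed

lemma card_basis: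
  fixes B :: "('k::field ^ 'n::finite) set"
  assumes "vec.independent B" "UNIV \<subseteq> vec.span B"
  shows "card B = CARD('n)"
  using vec.basis_card_eq_dim[of B UNIV] assms card_cart_basis by (metis subset_UNIV vec.dim_UNIV)

text \<open>Built from the small end of the chain: a basis for \<open>V N\<close> is extended
  successively to the larger sets, so the basis chosen for each \<open>V i\<close> remains inside
  \<open>B \<inter> V i\<close>.\<close>

lemma adapted_basis:
  fixes V :: "nat \<Rightarrow> ('k::field ^ 'n::finite) set"
  assumes "\<And>i j. i \<le> j \<Longrightarrow> V j \<subseteq> V i" and "k \<le> N"
  obtains B where "B \<subseteq> V k" "vec.independent B" "\<And>i. i \<in> {k..N} \<Longrightarrow> V i \<subseteq> vec.span (B \<inter> V i)"
proof -
  have "\<exists>B \<subseteq> V k. vec.independent B \<and> (\<forall>i\<in>{k..N}. V i \<subseteq> vec.span (B \<inter> V i))"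
    using assms(2)
  proof (induction rule: inc_induct)
    case base
    obtain B where "B \<subseteq> V N" "vec.independent B" "V N \<subseteq> vec.span B"
      using vec.maximal_independent_subset by blast
    then show ?case by (intro exI[of _ B]) (auto simp: Int_absorb2)
  next
    case (step k)
    then obtain B where B: "B \<subseteq> V (Suc k)" "vec.independent B"
      "\<forall>i\<in>{Suc k..N}. V i \<subseteq> vec.span (B \<inter> V i)" by blast
    then have "B \<subseteq> V k" using assms(1)[of k "Suc k"] by auto
    then obtain B' where B': "B \<subseteq> B'" "B' \<subseteq> V k" "vec.independent B'" "V k \<subseteq> vec.span B'"
      using vec.maximal_independent_subset_extend B(2) by blast
    have "V i \<subseteq> vec.span (B' \<inter> V i)" if "i \<in> {k..N}" for i
    proof (cases "i = k")
      case True
      then show ?thesis using B'(2,4) by (simp add: Int_absorb2)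
    next
      case False
      then have "V i \<subseteq> vec.span (B \<inter> V i)" using that B(3) by auto
      also have "\<dots> \<subseteq> vec.span (B' \<inter> V i)" by (rule vec.span_mono) (use B'(1) in auto)
      finally show ?thesis .
    qed
    then show ?case using B' by blast
  qed
  then show ?thesis using that by blast
qed

lemma vector_matrix_mult_nth: "(c v* T) $ s = scalar_product c (column s T)"
  for c :: "'k::comm_semiring_1 ^ 'm"
  by (simp add: vector_matrix_mult_def scalar_product_def column_def mult.commute)

text \<open>Sort a basis adapted to the chain \<open>V\<^sub>i = {v. c\<^sub>j\<^sup>t v = 0 for all j \<le> i}\<close> by depth in the chain.
  Then \<open>b\<^sub>i \<in> V\<^sub>i\<close> has coordinates only among the last basis vectors, and those are killed by \<open>c\<^sub>i\<close>.\<close>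

lemma ex_triangularizing_basis:
  fixes b c :: "nat \<Rightarrow> 'k::field ^ 'n::{finite,linorder}"
  assumes orth: "\<And>i j. 1 \<le> j \<Longrightarrow> j \<le> i \<Longrightarrow> i \<le> N \<Longrightarrow> scalar_product (c j) (b i) = 0"
  obtains T :: "'k ^ 'n::{finite,linorder} ^ 'n::{finite,linorder}" where "invertible T"
    "\<And>i r s. i \<in> {1..N} \<Longrightarrow> r \<le> s \<Longrightarrow> (matrix_inv T *v b i) $ r * (c i v* T) $ s = 0"
proof -
  define V where "V k = {v. \<forall>j\<in>{1..k}. scalar_product (c j) v = 0}" for k
  have anti: "V j \<subseteq> V i" if "i \<le> j" for i j using that by (auto simp: V_def)
  obtain B where B: "vec.independent B" "\<And>i. i \<in> {0..N} \<Longrightarrow> V i \<subseteq> vec.span (B \<inter> V i)"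
    by (rule adapted_basis[of V 0 N]) (use anti in auto)
  \<comment> \<open>The condition that defines \<open>V 0\<close> is empty, so \<open>V 0\<close> is
    the whole space and \<open>B\<close> is a basis of K^n.\<close>
  have "UNIV \<subseteq> vec.span B"
    using B(2)[of 0] by (simp add: V_def)
  then have cardB: "card B = CARD('n)" using B(1) by (rule card_basis[rotated])
  have finB: "finite B" using B(1) by (rule vec.finiteI_independent)
  \<comment> \<open>The chain decreases, so the indices k with \<open>v \<in> V k\<close> form an
    initial segment of 1,...,N; counting them gives the depth of \<open>v\<close>.\<close>
  define level where "level v = card {k\<in>{1..N}. v \<in> V k}" for v
  have level: "v \<in> V k \<longleftrightarrow> k \<le> level v" if "k \<in> {1..N}" for v k
  proof
    assume "v \<in> V k"
    then have "{1..k} \<subseteq> {k\<in>{1..N}. v \<in> V k}" using that anti by fastforce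
    from card_mono[OF _ this] show "k \<le> level v" by (simp add: level_def)
  next
    assume k: "k \<le> level v"
    show "v \<in> V k"
    proof (rule ccontr)
      assume "v \<notin> V k"
      then have "{k\<in>{1..N}. v \<in> V k} \<subseteq> {1..<k}" 
        using anti by (auto simp: V_def)
      from card_mono[OF _ this] show False using k that by (auto simp: level_def)
    qed
  qed
  obtain xs0 where xs0: "set xs0 = B" "distinct xs0" using finite_distinct_list[OF finB] by blast
  define xs where "xs = sort_key level xs0"
  have xs: "set xs = B" "distinct xs" "length xs = CARD('n)" "sorted (map level xs)"
    using xs0 cardB distinct_card[OF xs0(2)] by (simp_all add: xs_def)
  define f :: "'n \<Rightarrow> 'k ^ 'n::{finite,linorder}" where "f s = xs ! pos s" for s
  have inj: "inj f"
    using xs(2,3) by (auto simp: inj_on_def f_def nth_eq_iff_index_eq pos_less_CARD pos_eq_iff)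
  have range: "range f = B"
    using bij_betw_imp_surj_on[OF bij_betw_pos[where ?'n = 'n]] xs(1,3)
    by (auto simp: f_def set_conv_nth image_iff) (metis lessThan_iff rangeE)
  have mono: "level (f r) \<le> level (f s)" if "r \<le> s" for r s
    using sorted_nth_mono[OF xs(4), of "pos r" "pos s"] that
    by (simp add: f_def xs(3) pos_less_CARD pos_le_iff)
  define T where "T = (\<chi> r s. f s $ r)"
  have col: "column s T = f s" for s by (simp add: T_def column_def vec_eq_iff)
  have inv: "invertible T"
    unfolding T_def by (rule invertible_if_independent_columns) (simp_all add: inj range B(1))
  moreover have "(matrix_inv T *v b i) $ r * (c i v* T) $ s = 0" if i: "i \<in> {1..N}" and "r \<le> s" for i r s
  proof -
    have "b i \<in> V i" using orth i by (auto simp: V_def)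
    then have "b i \<in> vec.span (B \<inter> V i)" using B(2)[of i] i by auto
    then obtain u where u: "b i = (\<Sum>v\<in>B \<inter> V i. u v *s v)"
      using vec.span_finite[of "B \<inter> V i"] finB by auto
    \<comment> \<open>The coordinate vector of \<open>b i\<close> in the sorted basis; its support
      consists of positions whose basis vector has depth at least i.\<close>
    define x :: "'k ^ 'n::{finite,linorder}" where "x = (\<chi> s. if f s \<in> V i then u (f s) else 0)"
    have "T *v x = (\<Sum>s\<in>UNIV. x $ s *s f s)"
      by (simp add: matrix_mult_sum col)
    also have "\<dots> = (\<Sum>v\<in>B. (if v \<in> V i then u v else 0) *s v)"
      unfolding range[symmetric] sum.reindex[OF inj] by (simp add: x_def)
    also have "\<dots> = b i"
      unfolding u using finB by (intro sum.mono_neutral_cong_right) auto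
    finally have "matrix_inv T *v b i = x"
      by (metis inv matrix_inv_left matrix_vector_mul_assoc matrix_vector_mul_lid)
    moreover have "(c i v* T) $ s = 0" if "f r \<in> V i"
    proof -
      have "f s \<in> V i" using that mono[OF \<open>r \<le> s\<close>] level[OF i] by auto
      then show ?thesis using i by (simp add: vector_matrix_mult_nth col V_def)
    qed
    ultimately show ?thesis by (auto simp: x_def)
  qed
  ultimately show ?thesis using that by blast
qed

text \<open>Extending n-1 independent vectors to a basis yields a further vector \<open>w\<close>.
  It is put in the column of rank 0, so that \<open>b i\<close> occupies the column of rank
  i.\<close>

lemma ex_basis_completion:
  fixes b :: "nat \<Rightarrow> 'k::field ^ 'n::{finite,linorder}"
  assumes inj: "inj_on b {1..CARD('n) - 1}" and indep: "vec.independent (b ` {1..CARD('n) - 1})"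
  obtains T :: "'k ^ 'n::{finite,linorder} ^ 'n::{finite,linorder}" where "invertible T" "\<And>s. pos s \<noteq> 0 \<Longrightarrow> column s T = b (pos s)"
proof -
  obtain B where B: "b ` {1..CARD('n) - 1} \<subseteq> B" "vec.independent B" "UNIV \<subseteq> vec.span B"
    using vec.maximal_independent_subset_extend[OF subset_UNIV indep] by metis
  have cardB: "card B = CARD('n)" using B(2,3) by (rule card_basis)
  have "CARD('n) > 0" by simp
  then have "card (b ` {1..CARD('n) - 1}) < card B"
    unfolding card_image[OF inj] cardB by simp
  then obtain w where w: "w \<in> B" "w \<notin> b ` {1..CARD('n) - 1}"
    using B(1) by (metis less_irrefl subset_antisym subsetI)
  define f :: "'n \<Rightarrow> 'k ^ 'n::{finite,linorder}" where "f s = (if pos s = 0 then w else b (pos s))" for s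
  have range: "pos s \<in> {1..CARD('n) - 1}" if "pos s \<noteq> 0" for s :: 'n
    using pos_less_CARD[of s] that by auto
  have "inj f"
  proof (rule injI)
    fix r s assume "f r = f s"
    then show "r = s"
      using w(2) range[of r] range[of s] inj_onD[OF inj, of "pos r" "pos s"]
      by (auto simp: f_def pos_eq_iff simp del: atLeastAtMost_iff split: if_splits)
        (metis pos_eq_iff)
  qed
  moreover have "range f \<subseteq> B" using B(1) w(1) range by (auto simp: f_def)
  then have "vec.independent (range f)" using B(2) vec.independent_mono by blast
  ultimately have "invertible (\<chi> r s. f s $ r)" by (rule invertible_if_independent_columns)
  moreover have "column s (\<chi> r s. f s $ r) = b (pos s)" if "pos s \<noteq> 0" for s
    using that by (simp add: f_def column_def vec_eq_iff)
  ultimately show ?thesis by (rule that)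
qed

section \<open>Sums of powers of linear forms\<close>

lemma jacobian_power_map_nth:
  "jacobian_matrix (power_map c e b) $ r $ s =
    of_nat e * lform c ^ (e - 1) * Const (c $ s) * Const (b $ r)"
  by (simp add: jacobian_matrix_def power_map_nth partial_deriv_mult partial_deriv_power
      partial_deriv_lform)

lemma power_map_eq_0: "c = 0 \<and> e \<ge> 1 \<or> b = 0 \<Longrightarrow> power_map c e b = 0"
  by (auto simp: vec_eq_iff[of "power_map c e b"] power_map_nth power_0_left)

text \<open>For nonzero \<open>c\<close> the common factor e (c^t x)^(e-1) of the Jacobian is
  nonzero, by characteristic zero and the lack of zero divisors. Only the rank one matrix b c^t
  decides about triangularity.\<close>

lemma strictly_lower_power_map_iff:
  fixes c b :: "'k::field_char_0 ^ 'n::{finite,linorder}"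
  assumes "e \<ge> 1"
  shows "strictly_lower (jacobian_matrix (power_map c e b)) \<longleftrightarrow>
    (\<forall>r s. r \<le> s \<longrightarrow> b $ r * c $ s = 0)"
proof -
  have "jacobian_matrix (power_map c e b) $ r $ s = 0 \<longleftrightarrow> b $ r * c $ s = 0" for r s
  proof (cases "c = 0")
    case False
    then have "of_nat e * lform c ^ (e - 1) \<noteq> 0"
      using assms by (simp add: lform_eq_0_iff)
    then show ?thesis by (auto simp: jacobian_power_map_nth)
  qed (simp add: jacobian_power_map_nth)
  then show ?thesis by (simp add: strictly_lower_def)
qed

lemma strictly_lower_jacobian_sum:
  assumes "\<And>i. i \<in> A \<Longrightarrow> strictly_lower (jacobian_matrix (F i))"
  shows "strictly_lower (jacobian_matrix (sum F A))"
proof -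
  have "jacobian_matrix (sum F A) $ r $ s = (\<Sum>i\<in>A. jacobian_matrix (F i) $ r $ s)" for r s
    by (simp add: jacobian_matrix_def partial_deriv_sum)
  then show ?thesis using assms by (simp add: strictly_lower_def)
qed

text \<open>One \<open>T\<close> serves all terms separately. This is what (ii) asks for; (i)
  follows by summation.\<close>

lemma star_representation_triangularizable:
  fixes H :: "('k::field_char_0, 'n::{finite,linorder}) polymap"
  assumes star: "star_representation d N b c e H"
  obtains T where "invertible T"
    "\<And>i. i \<in> {1..N} \<Longrightarrow> strictly_lower (jacobian_matrix (conj_map T (power_map (c i) (e i) (b i))))"
proof -
  obtain T :: "'k ^ 'n::{finite,linorder} ^ 'n::{finite,linorder}" where "invertible T" and T:
    "\<And>i r s. i \<in> {1..N} \<Longrightarrow> r \<le> s \<Longrightarrow> (matrix_inv T *v b i) $ r * (c i v* T) $ s = 0"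
    using star by (rule_tac ex_triangularizing_basis[of N c b]) (auto simp: star_representation_def)
  have "strictly_lower (jacobian_matrix (conj_map T (power_map (c i) (e i) (b i))))" if "i \<in> {1..N}" for i
  proof -
    have "e i \<ge> 1" using star that by (auto simp: star_representation_def)
    then show ?thesis
      unfolding conj_map_power_map using T[OF that] by (simp add: strictly_lower_power_map_iff)
  qed
  with \<open>invertible T\<close> show ?thesis by (rule that)
qed

text \<open>\<open>\<rho> x\<close> separates the supports: \<open>c x\<close> lives before it and
  \<open>b x\<close> from it on. Once the terms are sorted by \<open>\<rho>\<close>, for j at most i
  the support of c_j ends before that of b_i begins. Sorting keeps the number of terms, which (ii)
  relies on.\<close>

lemma star_representation_sort:
  fixes b c :: "'a \<Rightarrow> 'k::comm_semiring_1 ^ 'n::{finite,linorder}" and \<rho> :: "'a \<Rightarrow> 'n"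
  assumes e: "\<And>x. x \<in> set xs \<Longrightarrow> e x \<in> {1..d}"
    and b: "\<And>x r. x \<in> set xs \<Longrightarrow> r < \<rho> x \<Longrightarrow> b x $ r = 0"
    and c: "\<And>x s. x \<in> set xs \<Longrightarrow> \<rho> x \<le> s \<Longrightarrow> c x $ s = 0"
  obtains b' c' e' where
    "star_representation d (length xs) b' c' e' (\<Sum>x\<leftarrow>xs. power_map (c x) (e x) (b x))"
proof
  define ys where "ys = sort_key \<rho> xs"
  have ys: "mset ys = mset xs" "set ys = set xs" "length ys = length xs" "sorted (map \<rho> ys)"
    by (simp_all add: ys_def)
  let ?g = "\<lambda>x. power_map (c x) (e x) (b x)"
  \<comment> \<open>Representations are numbered from 1, lists from 0; hence the shift.\<close>
  have mem: "ys ! (i - 1) \<in> set xs" if "1 \<le> i" "i \<le> length xs" for i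
    using that nth_mem[of "i - 1" ys] by (simp add: ys(2,3))
  have "(\<Sum>x\<leftarrow>xs. ?g x) = (\<Sum>x\<leftarrow>ys. ?g x)"
    unfolding sum_mset_sum_list[symmetric] mset_map ys(1) ..
  also have "\<dots> = (\<Sum>i=1..length xs. ?g (ys ! (i - 1)))"
    by (simp add: sum_list_sum_nth ys(3) sum.atLeast1_atMost_eq atLeast0LessThan)
  finally have "(\<Sum>x\<leftarrow>xs. ?g x) = (\<Sum>i=1..length xs. ?g (ys ! (i - 1)))" .
  moreover have "scalar_product (c (ys ! (j - 1))) (b (ys ! (i - 1))) = 0"
    if "1 \<le> j" "j \<le> i" "i \<le> length xs" for i j
    unfolding scalar_product_def
  proof (intro sum.neutral ballI)
    fix s
    have "\<rho> (ys ! (j - 1)) \<le> \<rho> (ys ! (i - 1))"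
      using sorted_nth_mono[OF ys(4), of "j - 1" "i - 1"] that by (simp add: ys(3))
    then show "c (ys ! (j - 1)) $ s * b (ys ! (i - 1)) $ s = 0"
      using b[OF mem[of i], of s] c[OF mem[of j], of s] that by (cases "s < \<rho> (ys ! (i - 1))") auto
  qed
  ultimately show "star_representation d (length xs) (\<lambda>i. b (ys ! (i - 1))) (\<lambda>i. c (ys ! (i - 1)))
      (\<lambda>i. e (ys ! (i - 1))) (\<Sum>x\<leftarrow>xs. ?g x)"
    using e mem by (simp add: star_representation_def)
qed

text \<open>A term \<open>(c, e, a, r)\<close> stands for the map with the single nonzero component
  \<open>(c\<^sup>t x)\<^sup>e a\<close> in position \<open>r\<close>.\<close>

definition triangular_power_sum :: "nat \<Rightarrow> ('k::comm_semiring_1, 'n::{finite,linorder}) polymap \<Rightarrow> bool" where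
  "triangular_power_sum d G \<longleftrightarrow> (\<exists>xs.
     (\<forall>(c, e, a, r)\<in>set xs. e \<in> {1..d} \<and> (\<forall>s\<ge>r. c $ s = 0)) \<and>
     G = (\<Sum>(c, e, a, r)\<leftarrow>xs. power_map c e (axis r a)))"

lemma triangular_power_sum_0: "triangular_power_sum d 0"
  unfolding triangular_power_sum_def by (rule exI[of _ "[]"]) simp

lemma triangular_power_sum_add:
  assumes "triangular_power_sum d F" "triangular_power_sum d G"
  shows "triangular_power_sum d (F + G)"
proof -
  from assms obtain xs ys where
    "\<forall>(c, e, a, r)\<in>set xs. e \<in> {1..d} \<and> (\<forall>s\<ge>r. c $ s = 0)"
    "F = (\<Sum>(c, e, a, r)\<leftarrow>xs. power_map c e (axis r a))"
    "\<forall>(c, e, a, r)\<in>set ys. e \<in> {1..d} \<and> (\<forall>s\<ge>r. c $ s = 0)"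
    "G = (\<Sum>(c, e, a, r)\<leftarrow>ys. power_map c e (axis r a))"
    unfolding triangular_power_sum_def by blast
  then show ?thesis
    unfolding triangular_power_sum_def by (intro exI[of _ "xs @ ys"]) auto
qed

lemma triangular_power_sum_sum:
  "(\<And>i. i \<in> A \<Longrightarrow> triangular_power_sum d (F i)) \<Longrightarrow> triangular_power_sum d (sum F A)"
  by (induction A rule: infinite_finite_induct)
    (auto intro: triangular_power_sum_0 triangular_power_sum_add)

lemma triangular_power_sum_axis:
  fixes f :: "('k::comm_semiring_1, 'n::{finite,linorder}) mpoly"
  assumes "f \<in> power_span {r..} e" "e \<in> {1..d}"
  shows "triangular_power_sum d (axis r f)"
  using assms(1)
proof (induction rule: power_span.induct)
  case zero
  have "axis r 0 = (0 :: ('k, 'n::{finite,linorder}) polymap)" by (simp add: axis_def vec_eq_iff)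
  then show ?case by (metis triangular_power_sum_0)
next
  case (step f c a)
  have "triangular_power_sum d (power_map c e (axis r a))"
    unfolding triangular_power_sum_def
    by (rule exI[of _ "[(c, e, a, r)]"]) (use step assms(2) in auto)
  moreover have "axis r (lform c ^ e * Const a + f) = power_map c e (axis r a) + axis r f"
    by (simp add: vec_eq_iff power_map_nth axis_def)
  ultimately show ?case using step.IH by (simp add: triangular_power_sum_add)
qed

text \<open>Component r contains no variable from r on, so each of its monomials splits into powers
  of linear forms in the earlier variables. The powers have the degree of the monomial as exponent,
  which lies in 1..d.\<close>

lemma strictly_lower_imp_triangular_power_sum:
  fixes G :: "('k::field_char_0, 'n::{finite,linorder}) polymap"
  assumes "strictly_lower (jacobian_matrix G)" and deg: "\<And>r. degrees_in {1..d} (G $ r)"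
  shows "triangular_power_sum d G"
proof -
  have "G = (\<Sum>r\<in>UNIV. \<Sum>m\<in>Poly_Mapping.keys (G $ r).
      axis r (Poly_Mapping.single m (Poly_Mapping.lookup (G $ r) m)))"
  proof -
    have "(\<Sum>r\<in>UNIV. \<Sum>m\<in>Poly_Mapping.keys (G $ r).
        axis r (Poly_Mapping.single m (Poly_Mapping.lookup (G $ r) m))) $ i =
        (\<Sum>r\<in>UNIV. if r = i then (\<Sum>m\<in>Poly_Mapping.keys (G $ i).
          Poly_Mapping.single m (Poly_Mapping.lookup (G $ i) m)) else 0)" for i
      unfolding sum_component by (rule sum.cong) (auto simp: axis_def)
    then show ?thesis
      by (simp add: vec_eq_iff flip: poly_mapping_eq_sum_single)
  qed
  moreover have "triangular_power_sum d (axis r (Poly_Mapping.single m (Poly_Mapping.lookup (G $ r) m)))"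
    if m: "m \<in> Poly_Mapping.keys (G $ r)" for r m
  proof (rule triangular_power_sum_axis)
    have "partial_deriv s (G $ r) = 0" if "r \<le> s" for s
      using assms(1) that by (auto simp: strictly_lower_def jacobian_matrix_def)
    then show "Poly_Mapping.single m (Poly_Mapping.lookup (G $ r) m) \<in> power_span {r..} (mon_degree m)"
      using m by (intro single_in_power_span) (auto simp: partial_deriv_eq_0_iff)
    show "mon_degree m \<in> {1..d}"
      using deg[of r] m by (simp add: degrees_in_def)
  qed
  ultimately show ?thesis
    by (metis (no_types, lifting) triangular_power_sum_sum)
qed

lemma star_representation_if_triangular_power_sum:
  assumes "triangular_power_sum d G"
  obtains N b c e where "star_representation d N b c e G"
proof -
  obtain xs where xs: "\<forall>(c, e, a, r)\<in>set xs. e \<in> {1..d} \<and> (\<forall>s\<ge>r. c $ s = 0)"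
    and G: "G = (\<Sum>(c, e, a, r)\<leftarrow>xs. power_map c e (axis r a))"
    using assms unfolding triangular_power_sum_def by blast
  let ?c = "\<lambda>(c, e, a, r). c" and ?e = "\<lambda>(c, e, a, r). e" and ?b = "\<lambda>(c, e, a, r). axis r a"
    and ?\<rho> = "\<lambda>(c, e, a, r). r"
  have "G = (\<Sum>x\<leftarrow>xs. power_map (?c x) (?e x) (?b x))"
    unfolding G by (intro arg_cong[of _ _ sum_list] map_cong) auto
  moreover obtain b' c' e' where
    "star_representation d (length xs) b' c' e' (\<Sum>x\<leftarrow>xs. power_map (?c x) (?e x) (?b x))"
    by (rule star_representation_sort[of xs ?e d ?\<rho> ?b ?c]) (use xs in \<open>fastforce simp: axis_def\<close>)+
  ultimately show ?thesis using that by metis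
qed

lemma linear_form_imp_lform:
  fixes l :: "('k::comm_semiring_1, 'n::finite) mpoly"
  assumes "linear_form l"
  obtains c where "l = lform c"
proof -
  have single: "Poly_Mapping.single m a \<in> range lform" if m: "mon_degree m = 1" for m :: "'n \<Rightarrow>\<^sub>0 nat" and a :: 'k
  proof -
    obtain i where i: "Poly_Mapping.lookup m i = 1" "\<And>j. i \<noteq> j \<Longrightarrow> Poly_Mapping.lookup m j = 0"
      using m sum_eq_Suc0_iff[of UNIV "Poly_Mapping.lookup m"] by (auto simp: mon_degree_def)
    then have "m = Poly_Mapping.single i 1"
      by (intro poly_mapping_eqI) (auto simp: lookup_single when_def)
    then have "Poly_Mapping.single m a = lform (axis i a)"
      by (simp add: lform_def axis_def Var_def Const_def mult_single if_distrib[of "Poly_Mapping.single 0"]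
          if_distrib[of "\<lambda>x. x * _"] cong: if_cong)
    then show ?thesis by blast
  qed
  have add: "f + g \<in> range lform" if fg: "f \<in> range lform" "g \<in> range lform"
    for f g :: "('k, 'n) mpoly"
  proof -
    obtain c d where "f = lform c" "g = lform d" using fg by blast
    then have "f + g = lform (c + d)" by (simp add: lform_add)
    then show ?thesis by blast
  qed
  have "(\<Sum>m\<in>A. Poly_Mapping.single m (Poly_Mapping.lookup l m)) \<in> range lform"
    if "\<And>m. m \<in> A \<Longrightarrow> mon_degree m = 1" for A
    using that
  proof (induction A rule: infinite_finite_induct)
    case (insert m A)
    then show ?case by (simp add: add single)
  qed (auto intro: range_eqI[of _ _ 0])
  from this[of "Poly_Mapping.keys l"] have "l \<in> range lform"
    using assms by (auto simp: linear_form_def homogeneous_def simp flip: poly_mapping_eq_sum_single)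
  then show ?thesis using that by blast
qed

section \<open>The four equivalences\<close>

lemma form_star_iff_strictly_lower:
  fixes H :: "('k::field_char_0, 'n::{finite,linorder}) polymap"
  assumes deg: "\<And>r. degrees_in {1..d} (H $ r)"
  shows "form_star d H \<longleftrightarrow> (\<exists>T. invertible T \<and> strictly_lower (jacobian_matrix (conj_map T H)))"
proof
  assume "form_star d H"
  then obtain N b c e where star: "star_representation d N b c e H"
    by (auto simp: form_star_def)
  then obtain T where T: "invertible T"
    "\<And>i. i \<in> {1..N} \<Longrightarrow> strictly_lower (jacobian_matrix (conj_map T (power_map (c i) (e i) (b i))))"
    by (rule star_representation_triangularizable) blast
  have H: "conj_map T H = (\<Sum>i=1..N. conj_map T (power_map (c i) (e i) (b i)))"
    using star by (simp add: star_representation_def conj_map_sum)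
  have "strictly_lower (jacobian_matrix (conj_map T H))"
    unfolding H by (rule strictly_lower_jacobian_sum) (rule T(2))
  with T(1) show "\<exists>T. invertible T \<and> strictly_lower (jacobian_matrix (conj_map T H))"
    by blast
next
  assume "\<exists>T. invertible T \<and> strictly_lower (jacobian_matrix (conj_map T H))"
  then obtain T where T: "invertible T" "strictly_lower (jacobian_matrix (conj_map T H))" by blast
  then have "triangular_power_sum d (conj_map T H)"
    by (intro strictly_lower_imp_triangular_power_sum degrees_in_conj_map deg)
  then obtain N b c e where "star_representation d N b c e (conj_map T H)"
    by (rule star_representation_if_triangular_power_sum)
  from star_representation_from_conj_map[OF T(1) this] show "form_star d H"
    unfolding form_star_def by blast
qed

text \<open>Nilpotency travels along the conjugation in both directions: back to H from the strictly
  triangular Jacobian, and forward to the triangular one, where it forces the diagonal to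
  vanish.\<close>

lemma strictly_lower_iff_triangularizable_nilpotent:
  fixes H :: "('k::field_char_0, 'n::{finite,linorder}) polymap"
  shows "(\<exists>T. invertible T \<and> strictly_lower (jacobian_matrix (conj_map T H))) \<longleftrightarrow>
    linearly_triangularizable H \<and> nilpotent_matrix (jacobian_matrix H)"
proof
  assume "\<exists>T. invertible T \<and> strictly_lower (jacobian_matrix (conj_map T H))"
  then obtain T where T: "invertible T" "strictly_lower (jacobian_matrix (conj_map T H))" by blast
  then have "nilpotent_matrix (jacobian_matrix (conj_map (matrix_inv T) (conj_map T H)))"
    by (intro nilpotent_jacobian_conj_map invertible_matrix_inv strictly_lower_imp_nilpotent)
  with T show "linearly_triangularizable H \<and> nilpotent_matrix (jacobian_matrix H)"
    by (auto simp: conj_map_matrix_inv linearly_triangularizable_def strictly_lower_iff)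
next
  assume H: "linearly_triangularizable H \<and> nilpotent_matrix (jacobian_matrix H)"
  have "\<exists>T. invertible T \<and> lower_triangular (jacobian_matrix (conj_map T H))"
  proof -
    obtain T where T: "invertible T"
      "lower_triangular (jacobian_matrix (conj_map T H)) \<or> upper_triangular (jacobian_matrix (conj_map T H))"
      using H by (auto simp: linearly_triangularizable_def)
    show ?thesis
    proof (cases "lower_triangular (jacobian_matrix (conj_map T H))")
      case False
      then obtain P where P: "invertible P" "lower_triangular (jacobian_matrix (conj_map P (conj_map T H)))"
        using T(2) conj_map_upper_to_lower by blast
      then show ?thesis
        using T(1) by (auto simp: conj_map_conj_map intro!: exI[of _ "T ** P"] invertible_mult)
    qed (use T in blast)
  qed
  with H show "\<exists>T. invertible T \<and> strictly_lower (jacobian_matrix (conj_map T H))"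
    using lower_triangular_nilpotent_imp_strictly_lower nilpotent_jacobian_conj_map by blast
qed

text \<open>From right to left the n-1 given terms must themselves be put in order, by the first
  nonzero entry of the transformed \<open>b i\<close>. Termwise triangularity is exactly what makes
  this position a separating one.\<close>

lemma form_star2_iff:
  fixes H :: "('k::field_char_0, 'n::{finite,linorder}) polymap"
  shows "form_star2 d H \<longleftrightarrow>
    (\<exists>b c e T. invertible T \<and> (\<forall>i\<in>{1..CARD('n) - 1}. e i \<in> {1..d}) \<and>
       H = (\<Sum>i=1..CARD('n) - 1. power_map (c i) (e i) (b i)) \<and>
       (\<forall>i\<in>{1..CARD('n) - 1}.
          strictly_lower (jacobian_matrix (conj_map T (power_map (c i) (e i) (b i))))))"
    (is "_ \<longleftrightarrow> ?R")
proof
  assume "form_star2 d H"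
  then obtain b c e where star: "star_representation d (CARD('n) - 1) b c e H"
    by (auto simp: form_star2_def)
  then obtain T where "invertible T" "\<And>i. i \<in> {1..CARD('n) - 1} \<Longrightarrow>
      strictly_lower (jacobian_matrix (conj_map T (power_map (c i) (e i) (b i))))"
    by (rule star_representation_triangularizable) blast
  with star show ?R
    by (intro exI[of _ b] exI[of _ c] exI[of _ e] exI[of _ T]) (auto simp: star_representation_def)
next
  let ?N = "CARD('n) - 1"
  assume ?R
  then obtain b c e T where T: "invertible T" and e: "\<And>i. i \<in> {1..?N} \<Longrightarrow> e i \<in> {1..d}"
    and H: "H = (\<Sum>i=1..?N. power_map (c i) (e i) (b i))"
    and low: "\<And>i. i \<in> {1..?N} \<Longrightarrow> strictly_lower (jacobian_matrix (conj_map T (power_map (c i) (e i) (b i))))"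
    by blast
  define b1 c1 where "b1 i = matrix_inv T *v b i" and "c1 i = c i v* T" for i
  define ok where "ok i \<longleftrightarrow> b1 i \<noteq> 0 \<and> c1 i \<noteq> 0" for i
  \<comment> \<open>If one of the two vectors is zero, the other is unrestricted and could violate
    orthogonality with other terms. The term is zero anyway, so both vectors are set to 0 and the
    count n-1 is kept.\<close>
  define b2 c2 where "b2 i = (if ok i then b1 i else 0)" and "c2 i = (if ok i then c1 i else 0)" for i
  \<comment> \<open>For degenerate terms both vectors are now zero, so any position separates their
    supports.\<close>
  define \<rho> where "\<rho> i = (if ok i then Min {r. b1 i $ r \<noteq> 0} else undefined)" for i
  have e1: "e i \<ge> 1" if "i \<in> {1..?N}" for i
    using e[OF that] by simp
  have prod: "b1 i $ r * c1 i $ s = 0" if "i \<in> {1..?N}" "r \<le> s" for i r s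
    using low[OF that(1)] that(2) e1[OF that(1)]
    by (simp add: conj_map_power_map strictly_lower_power_map_iff b1_def c1_def)
  have "conj_map T H = (\<Sum>i=1..?N. power_map (c1 i) (e i) (b1 i))"
    unfolding H conj_map_sum by (simp add: conj_map_power_map b1_def c1_def)
  also have "\<dots> = (\<Sum>i=1..?N. power_map (c2 i) (e i) (b2 i))"
  proof (rule sum.cong)
    fix i assume "i \<in> {1..?N}"
    then show "power_map (c1 i) (e i) (b1 i) = power_map (c2 i) (e i) (b2 i)"
      using e1[of i] by (auto simp: b2_def c2_def ok_def power_map_eq_0)
  qed simp
  also have "\<dots> = (\<Sum>i\<leftarrow>[1..<Suc ?N]. power_map (c2 i) (e i) (b2 i))"
    by (simp only: sum_list_distinct_conv_sum_set distinct_upt set_upt atLeastLessThanSuc_atLeastAtMost)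
  finally have G: "conj_map T H = (\<Sum>i\<leftarrow>[1..<Suc ?N]. power_map (c2 i) (e i) (b2 i))" .
  have min: "b1 i $ \<rho> i \<noteq> 0" "r < \<rho> i \<Longrightarrow> b1 i $ r = 0" if "ok i" for i r
  proof -
    have ne: "{r. b1 i $ r \<noteq> 0} \<noteq> {}" using that by (auto simp: ok_def vec_eq_iff)
    from Min_in[OF _ ne] show "b1 i $ \<rho> i \<noteq> 0" using that by (simp add: \<rho>_def)
    show "b1 i $ r = 0" if "r < \<rho> i"
    proof (rule ccontr)
      assume "b1 i $ r \<noteq> 0"
      then have "Min {r. b1 i $ r \<noteq> 0} \<le> r" by (intro Min_le) auto
      then show False using that \<open>ok i\<close> by (simp add: \<rho>_def)
    qed
  qed
  obtain b' c' e' where "star_representation d (length [1..<Suc ?N]) b' c' e' (conj_map T H)"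
    unfolding G
  proof (rule star_representation_sort[of "[1..<Suc ?N]" e d \<rho> b2 c2])
    show "b2 i $ r = 0" if "r < \<rho> i" for i r
      using min(2)[of i r] that by (simp add: b2_def)
    show "c2 i $ s = 0" if "i \<in> set [1..<Suc ?N]" "\<rho> i \<le> s" for i s
      using prod[of i "\<rho> i" s] min(1)[of i] that by (auto simp: c2_def)
  qed (use e in auto)
  then have "star_representation d ?N b' c' e' (conj_map T H)" by simp
  then show "form_star2 d H"
    unfolding form_star2_def using star_representation_from_conj_map[OF T] by blast
qed

lemma matrix_vector_mult_axis: "A *v axis s 1 = column s A"
  for A :: "'k::comm_semiring_1 ^ 'n::finite ^ 'm::finite"
  by (simp add: vec_eq_iff matrix_vector_mult_def column_def axis_def if_distrib cong: if_cong)

text \<open>In the completed basis \<open>b i\<close> becomes the unit vector at rank i, so the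
  terms do not mix: each component receives a single power, and the component of rank 0 receives
  none.\<close>

lemma form_star3_imp_powers:
  fixes H :: "('k::field_char_0, 'n::{finite,linorder}) polymap"
  assumes "form_star3 d H"
  obtains T where "invertible T" "\<And>r. \<exists>l k. linear_form l \<and> conj_map T H $ r = l ^ k"
    "strictly_lower (jacobian_matrix (conj_map T H))"
proof -
  let ?N = "CARD('n) - 1"
  obtain b c e where star: "star_representation d ?N b c e H"
    and b: "inj_on b {1..?N}" "vec.independent (b ` {1..?N})"
    using assms by (auto simp: form_star3_def)
  obtain T :: "'k ^ 'n::{finite,linorder} ^ 'n::{finite,linorder}" where T: "invertible T"
    and col: "\<And>s. pos s \<noteq> 0 \<Longrightarrow> column s T = b (pos s)"
    using ex_basis_completion[OF b] by blast
  have pos: "pos r \<in> {1..?N}" if "pos r \<noteq> 0" for r :: 'n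
    using pos_less_CARD[of r] that by auto
  have Tb: "(matrix_inv T *v b i) $ r = (if pos r = i then 1 else 0)" if "i \<in> {1..?N}" for i r
  proof -
    have "i < CARD('n)" using that by auto
    then obtain s :: 'n where s: "pos s = i" by (rule obtain_pos)
    then have "b i = T *v axis s 1" using that col[of s] by (simp add: matrix_vector_mult_axis)
    then have "matrix_inv T *v b i = axis s 1"
      by (simp add: matrix_vector_mul_assoc matrix_inv_left[OF T])
    then show ?thesis using s by (auto simp: axis_def pos_eq_iff)
  qed
  have H: "conj_map T H = (\<Sum>i=1..?N. power_map (c i v* T) (e i) (matrix_inv T *v b i))"
    using star by (simp add: star_representation_def conj_map_sum conj_map_power_map)
  have "\<exists>l k. linear_form l \<and> conj_map T H $ r = l ^ k" for r
  proof -
    have "conj_map T H $ r = (\<Sum>i=1..?N. if i = pos r then lform (c i v* T) ^ e i else 0)"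
      unfolding H sum_component by (rule sum.cong) (auto simp: power_map_nth Tb)
    \<comment> \<open>The vanishing first component is written as \<open>0 ^ 1\<close>, a power of
      the zero linear form.\<close>
    also have "\<dots> = (if pos r = 0 then 0 ^ 1 else lform (c (pos r) v* T) ^ e (pos r))"
      using pos[of r] by auto
    finally show ?thesis
      using homogeneous_lform[of "c (pos r) v* T"] by (cases "pos r = 0") (auto simp: linear_form_def)
  qed
  moreover have "strictly_lower (jacobian_matrix (conj_map T H))"
    unfolding H
  proof (rule strictly_lower_jacobian_sum)
    fix i assume i: "i \<in> {1..?N}"
    then have "e i \<ge> 1" using star by (auto simp: star_representation_def)
    \<comment> \<open>Only the row of rank i matters. There, entry s of T^t c_i is c_i^t b_k with k
      the rank of s, and k is at least i, so the orthogonality relation applies.\<close>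
    moreover have "(matrix_inv T *v b i) $ r * (c i v* T) $ s = 0" if "r \<le> s" for r s
    proof (cases "pos r = i")
      case True
      then have "1 \<le> i" "i \<le> pos s" "pos s \<in> {1..?N}"
        using i that pos[of s] by (auto simp flip: pos_le_iff)
      then have "scalar_product (c i) (b (pos s)) = 0" "column s T = b (pos s)"
        using star col[of s] by (auto simp: star_representation_def)
      then show ?thesis by (simp add: vector_matrix_mult_nth)
    qed (simp add: Tb[OF i])
    ultimately show "strictly_lower (jacobian_matrix (power_map (c i v* T) (e i) (matrix_inv T *v b i)))"
      by (simp add: strictly_lower_power_map_iff)
  qed
  ultimately show ?thesis using that T by blast
qed

lemma powers_imp_form_star3:
  fixes H :: "('k::field_char_0, 'n::{finite,linorder}) polymap"
  assumes deg: "\<And>r. degrees_in {1..d} (H $ r)" and "d \<ge> 1"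
    and T: "invertible T"
    and powers: "\<And>r. \<exists>l k. linear_form l \<and> conj_map T H $ r = l ^ k"
    and low: "strictly_lower (jacobian_matrix (conj_map T H))"
  shows "form_star3 d H"
proof -
  let ?N = "CARD('n) - 1"
  define G where "G = conj_map T H"
  have "\<exists>c e. e \<in> {1..d} \<and> G $ r = lform c ^ e \<and> (\<forall>s\<ge>r. c $ s = 0)" for r
  \<comment> \<open>A zero component needs its own choice: 0 is a power of the zero form with any
    positive exponent, possibly above d, so \<open>c = 0\<close> with exponent 1 is taken. A nonzero
    component is homogeneous of degree k, which places k in 1..d.\<close>
  proof (cases "G $ r = 0")
    case True
    then show ?thesis using \<open>d \<ge> 1\<close> by (intro exI[of _ 0] exI[of _ 1]) auto
  next
    case False
    obtain c k where ck: "G $ r = lform c ^ k"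
      using powers linear_form_imp_lform by (metis G_def)
    have "degrees_in {1..d} (G $ r)"
      unfolding G_def by (intro degrees_in_conj_map deg)
    moreover have "homogeneous k (G $ r)"
      unfolding ck by (rule homogeneous_lform_power)
    moreover obtain m where "m \<in> Poly_Mapping.keys (G $ r)"
      using False by (metis all_not_in_conv keys_eq_empty)
    ultimately have k: "k \<in> {1..d}" by (auto simp: degrees_in_def homogeneous_def)
    have "c $ s = 0" if "r \<le> s" for s
    proof -
      have "of_nat k * lform c ^ (k - 1) * Const (c $ s) = partial_deriv s (G $ r)"
        by (simp add: ck partial_deriv_power partial_deriv_lform)
      also have "\<dots> = 0"
        using low that by (simp add: strictly_lower_def jacobian_matrix_def G_def)
      finally show ?thesis using k False ck by auto
    qed
    with k ck show ?thesis by blast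
  qed
  then obtain c e where e: "\<And>r. e r \<in> {1..d}" and G: "\<And>r. G $ r = lform (c r) ^ e r"
    and c: "\<And>r s. r \<le> s \<Longrightarrow> c r $ s = 0"
    by metis
  have injT: "inj ((*v) T)" using T by (rule inj_matrix_vector_mult)
  have "\<exists>s :: 'n. pos s = i" if "i < CARD('n)" for i
    using that by (metis obtain_pos)
  \<comment> \<open>The inverse of the rank. The i-th term will be component
    \<open>\<sigma> i\<close> times its unit vector, for i = 1,...,n-1.\<close>
  then obtain \<sigma> :: "nat \<Rightarrow> 'n" where \<sigma>: "\<And>i. i < CARD('n) \<Longrightarrow> pos (\<sigma> i) = i"
    by metis
  have \<sigma>': "pos (\<sigma> i) = i" if "i \<le> ?N" for i
    using that by (intro \<sigma>) (metis Suc_pred' le_imp_less_Suc zero_less_card_finite)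
  have "star_representation d ?N (\<lambda>i. axis (\<sigma> i) 1) (\<lambda>i. c (\<sigma> i)) (\<lambda>i. e (\<sigma> i)) G"
    unfolding star_representation_def
  proof (intro conjI allI impI ballI)
    show "scalar_product (c (\<sigma> j)) (axis (\<sigma> i) 1) = 0" if "1 \<le> j \<and> j \<le> i \<and> i \<le> ?N" for i j
    proof -
      have "\<sigma> j \<le> \<sigma> i" using that by (simp add: \<sigma>' flip: pos_le_iff)
      then show ?thesis
        using c by (auto simp: scalar_product_def axis_def intro!: sum.neutral)
    qed
    have "G $ r = (\<Sum>i=1..?N. power_map (c (\<sigma> i)) (e (\<sigma> i)) (axis (\<sigma> i) 1)) $ r" for r
    proof -
      have "(\<Sum>i=1..?N. power_map (c (\<sigma> i)) (e (\<sigma> i)) (axis (\<sigma> i) 1)) $ r =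
          (\<Sum>i=1..?N. if i = pos r then G $ r else 0)"
        unfolding sum_component
      proof (rule sum.cong)
        fix i assume "i \<in> {1..?N}"
        then have "\<sigma> i = r \<longleftrightarrow> i = pos r" using \<sigma>'[of i] by (auto simp flip: pos_eq_iff)
        then show "power_map (c (\<sigma> i)) (e (\<sigma> i)) (axis (\<sigma> i) 1) $ r = (if i = pos r then G $ r else 0)"
          by (auto simp: power_map_nth axis_def G)
      qed simp
      also have "\<dots> = G $ r"
      proof (cases "pos r = 0")
        case True
        \<comment> \<open>The index of rank 0 is the one left out of the sum. It precedes every s,
          so \<open>c r\<close> is zero, and as the exponent is positive the component
          vanishes.\<close>
        then have "c r $ s = 0" for s using c[of r s] by (simp flip: pos_le_iff)
        then have "c r = 0" by (simp add: vec_eq_iff)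
        then show ?thesis using e[of r] True by (simp add: G power_0_left)
      next
        case False
        then show ?thesis using pos_less_CARD[of r] by auto
      qed
      finally show ?thesis by simp
    qed
    then show "G = (\<Sum>i=1..?N. power_map (c (\<sigma> i)) (e (\<sigma> i)) (axis (\<sigma> i) 1))"
      by (simp add: vec_eq_iff)
  qed (use e in auto)
  then have "star_representation d ?N (\<lambda>i. T *v axis (\<sigma> i) 1)
      (\<lambda>i. c (\<sigma> i) v* matrix_inv T) (\<lambda>i. e (\<sigma> i)) H"
    unfolding G_def by (rule star_representation_from_conj_map[OF T])
  moreover have "inj_on (\<lambda>i. T *v axis (\<sigma> i) (1::'k)) {1..?N}"
  proof (rule inj_onI)
    fix i j assume ij: "i \<in> {1..?N}" "j \<in> {1..?N}" "T *v axis (\<sigma> i) (1::'k) = T *v axis (\<sigma> j) 1"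
    then have "\<sigma> i = \<sigma> j" using injD[OF injT ij(3)] by (simp add: axis_eq_axis)
    then show "i = j" by (metis \<sigma>' atLeastAtMost_iff ij(1,2))
  qed
  moreover have "vec.independent ((\<lambda>i. T *v axis (\<sigma> i) (1::'k)) ` {1..?N})"
  proof -
    have "(\<lambda>i. axis (\<sigma> i) (1::'k)) ` {1..?N} \<subseteq> cart_basis"
      unfolding cart_basis_def by blast
    then have "vec.independent ((\<lambda>i. axis (\<sigma> i) (1::'k)) ` {1..?N})"
      by (rule vec.independent_mono[OF independent_cart_basis])
    then have "vec.independent ((*v) T ` (\<lambda>i. axis (\<sigma> i) (1::'k)) ` {1..?N})"
      by (rule vec.linear_independent_injective_image[OF matrix_vector_mul_linear_gen[of T]])
        (rule inj_on_subset[OF injT subset_UNIV])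
    then show ?thesis unfolding image_image .
  qed
  ultimately show ?thesis unfolding form_star3_def by blast
qed

theorem theorem2p3:
  fixes H :: "('k::field_char_0, 'n::{finite,linorder}) polymap"
    and d :: nat
  assumes "polymap_degree (id_map + H) = d"
    and "d \<ge> 1"
    and "polymap_apply H 0 = 0"
  shows
    "(form_star d H \<longleftrightarrow>
        (\<exists>T. invertible T \<and> lower_triangular (jacobian_matrix (conj_map T H)) \<and>
             zero_diagonal (jacobian_matrix (conj_map T H))))
     \<and> ((\<exists>T. invertible T \<and> lower_triangular (jacobian_matrix (conj_map T H)) \<and>
             zero_diagonal (jacobian_matrix (conj_map T H))) \<longleftrightarrow>
        linearly_triangularizable H \<and> nilpotent_matrix (jacobian_matrix H))
     \<and> (form_star2 d H \<longleftrightarrow>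
        (\<exists>b c e T. invertible T \<and>
             (\<forall>i\<in>{1..CARD('n) - 1}. e i \<in> {1..d}) \<and>
             H = (\<Sum>i=1..CARD('n) - 1. power_map (c i) (e i) (b i)) \<and>
             (\<forall>i\<in>{1..CARD('n) - 1}.
                lower_triangular (jacobian_matrix (conj_map T (power_map (c i) (e i) (b i)))) \<and>
                zero_diagonal (jacobian_matrix (conj_map T (power_map (c i) (e i) (b i)))))))
     \<and> (form_star3 d H \<longleftrightarrow>
        (\<exists>T. invertible T \<and>
             (\<forall>r. \<exists>l k. linear_form l \<and> conj_map T H $ r = l ^ k) \<and>
             lower_triangular (jacobian_matrix (conj_map T H)) \<and>
             zero_diagonal (jacobian_matrix (conj_map T H))))"
proof -
  have deg: "degrees_in {1..d} (H $ r)" for r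
    using assms by (rule degrees_in_if_polymap_degree)
  have "form_star3 d H \<longleftrightarrow> (\<exists>T. invertible T \<and>
      (\<forall>r. \<exists>l k. linear_form l \<and> conj_map T H $ r = l ^ k) \<and>
      strictly_lower (jacobian_matrix (conj_map T H)))"
    using form_star3_imp_powers powers_imp_form_star3[OF deg assms(2)] by metis
  then show ?thesis
    unfolding strictly_lower_iff[symmetric]
    using form_star_iff_strictly_lower[OF deg] strictly_lower_iff_triangularizable_nilpotent[of H]
      form_star2_iff[of d H] by (intro conjI)
qed

end
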